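(* Let $p\in[1,\infty)$, let $A$ be an invertible real $n\times n$ matrix, let $\rho_A(x,y)=\|A(x-y)\|_{\ell^\infty}=\max_{1\le i\le n}|(A(x-y))_i|$ for $x,y\in\mathbb R^n$, and let $f\in C_c^*(\mathbb R^n)$. Then there exists a constant $C>0$ such that $$\frac1C\int_{\mathbb R^n}|\nabla_Af(x)|^p\,dx\ \le\ \sup_{\lambda>0}\lambda^p\iint_{\mathbb R^n\times\mathbb R^n}\mathbf 1_{\left\{(x,y):\ \frac{|f(x)-f(y)|}{\rho_A(x,y)^{1+n/p}}>\lambda\right\}}\,dx\,dy\ \le\ C\int_{\mathbb R^n}|\nabla_Af(x)|^p\,dx,$$ where $\nabla_Af(x):=A^T\nabla f(x)$ is the anisotropic gradient of $f$.
   Context: $C_c^*(\mathbb R^n)$ is the class of Lipschitz functions $f:\mathbb R^n\to\mathbb R$ with compact support such that $\operatorname{Lip}f(x)=\limsup_{r\to0^+}\sup_{|y-x|<r}\frac{|f(x)-f(y)|}{r}$ is a continuous function with compact support and the convergence in this $\limsup$ is uniform, i.e. $\sup_{0<r<\delta}\sup_{|y-x|<r}\frac{|f(x)-f(y)|}{r}\to\operatorname{Lip}f(x)$ uniformly in $x$ as $\delta\to0^+$. *)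

theory Defs
  imports "HOL-Analysis.Analysis"
begin

definition has_compact_support :: "(real ^ 'n \<Rightarrow> real) \<Rightarrow> bool" where
  "has_compact_support f \<longleftrightarrow> compact (closure {x. f x \<noteq> 0})"

(* The suprema are taken in ereal, so that no boundedness side condition is hidden in them.  For
   Lipschitz f they are all finite, and the conversions to real below lose nothing. *)
definition lip_quot :: "(real ^ 'n \<Rightarrow> real) \<Rightarrow> real ^ 'n \<Rightarrow> real \<Rightarrow> ereal" where
  "lip_quot f x r = (SUP y\<in>ball x r. ereal (\<bar>f x - f y\<bar> / r))"

definition Lip :: "(real ^ 'n \<Rightarrow> real) \<Rightarrow> real ^ 'n \<Rightarrow> real" where
  "Lip f x = real_of_ereal (Limsup (at_right 0) (lip_quot f x))"

definition Cc_star :: "(real ^ 'n \<Rightarrow> real) set" where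
  "Cc_star = {f. (\<exists>L. L-lipschitz_on UNIV f) \<and> has_compact_support f \<and>
     continuous_on UNIV (Lip f) \<and> has_compact_support (Lip f) \<and>
     uniform_limit UNIV (\<lambda>\<delta> x. real_of_ereal (SUP r\<in>{0<..<\<delta>}. lip_quot f x r)) (Lip f) (at_right 0)}"

(* Members of Cc_star need not be differentiable everywhere (already for n = 1 there may be corners),
   only almost everywhere, by Rademacher's theorem.  The value 0 chosen at the remaining points is
   irrelevant to integrals of the gradient. *)
definition grad :: "(real ^ 'n \<Rightarrow> real) \<Rightarrow> real ^ 'n \<Rightarrow> real ^ 'n" where
  "grad f x = (if f differentiable (at x) then (THE D. GDERIV f x :> D) else 0)"

definition aniso_grad :: "real ^ 'n ^ 'n \<Rightarrow> (real ^ 'n \<Rightarrow> real) \<Rightarrow> real ^ 'n \<Rightarrow> real ^ 'n" where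
  "aniso_grad A f x = transpose A *v grad f x"

definition rho :: "real ^ 'n ^ 'n \<Rightarrow> real ^ 'n \<Rightarrow> real ^ 'n \<Rightarrow> real" where
  "rho A x y = infnorm (A *v (x - y))"

lemma rho_eq_Max: "rho A x y = (MAX i\<in>UNIV. \<bar>(A *v (x - y)) $ i\<bar>)"
proof -
  have "(\<lambda>b. \<bar>v \<bullet> b\<bar>) ` Basis = (\<lambda>i. \<bar>v $ i\<bar>) ` UNIV" for v :: "real ^ 'n"
    unfolding Basis_vec_def by (force simp: inner_axis)
  then show ?thesis
    unfolding rho_def infnorm_Max by (rule arg_cong)
qed

lemma grad_eqI:
  assumes "GDERIV f x :> D"
  shows "grad f x = D"
proof -
  have "E = D" if "GDERIV f x :> E" for E
  proof -
    have "(\<lambda>h. h \<bullet> E) = (\<lambda>h. h \<bullet> D)"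
      using that assms unfolding gderiv_def by (rule has_derivative_unique)
    then have "\<forall>h. h \<bullet> E = h \<bullet> D"
      by (rule fun_cong[THEN allI])
    then show ?thesis
      by (simp only: vector_eq_ldot)
  qed
  moreover have "f differentiable (at x)"
    using assms unfolding gderiv_def by (rule differentiableI)
  moreover have "(THE E. GDERIV f x :> E) = D"
    using assms calculation(1) by (rule the_equality)
  ultimately show ?thesis
    by (simp only: grad_def if_True)
qed

(* Since x / 0 = 0 in HOL, diagonal points (x, x) do not belong to the level set. *)
definition weak_energy :: "real \<Rightarrow> real ^ 'n ^ 'n \<Rightarrow> (real ^ 'n \<Rightarrow> real) \<Rightarrow> ennreal" where
  "weak_energy p A f =
     (SUP \<mu>\<in>{0<..}. ennreal (\<mu> powr p) *
       (\<integral>\<^sup>+ z. indicator {(x, y). \<bar>f x - f y\<bar> / rho A x y powr (1 + real CARD('n) / p) > \<mu>} z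
          \<partial>(lborel \<Otimes>\<^sub>M lborel)))"

end

theory Submission
  imports Defs
begin

text \<open>
Write n for the dimension. Both bounds are obtained from the pointwise slope Lip f and the gradient, which
are related by Lip f \<le> |grad f| at every point of differentiability (\<open>Lip_le_norm_grad\<close>).

Upper bound. Since Lip f is continuous, integrating it along a segment bounds the increment of f
(\<open>increment_le_integral_Lip\<close>). For a pair (x, x + h) in the level set at height \<mu>, this and a substitute for
Jensen's inequality show that the average of u = (Lip f / b)^p over the segment from x to x + h exceeds |h|^n,
where b is a fixed multiple of \<mu>. The set of all such (x, h) has measure at most a constant times \<integral> u
(\<open>segment_average_superlevel_bound\<close>): on each line one meets intervals of length \<sigma> that carry mass more
than \<sigma>^(n+1), a disjoint subfamily controls all of them by Vitali's covering lemma, and its masses add up to at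
most the mass of the line. The powers of \<mu> cancel, so the weak energy is at most a constant times
\<integral> (Lip f)^p (\<open>weak_energy_le_Lip\<close>), and it remains to show that f is differentiable almost everywhere.

Differentiability (\<open>AE_differentiable\<close>) is a consequence of the continuity of Lip f. Where Lip f vanishes it is
immediate, so let c = Lip f(x) > 0. By continuity f is (c + \<gamma>)-Lipschitz near x, while on suitable
arbitrarily short segments it climbs at rate at least c - \<gamma>; nearly the same is true of all slightly translated
parallel segments. By the rising sun lemma, from at least half of the points of each of them f climbs at
nearly the maximal rate, to both sides and on all smaller scales (\<open>nearly_extremal_portion\<close>). A function that climbs
in one direction as fast as its Lipschitz constant permits is almost affine (\<open>affine_of_extremal_direction\<close>). Hence in
arbitrarily small balls around x a fixed proportion of the points admits an affine approximation with relative
error \<epsilon>, and by a covering argument (\<open>negligible_of_porous\<close>) the exceptional points form a null set.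

Lower bound (\<open>aniso_grad_le_weak_energy\<close>). At a point x with gradient D \<noteq> 0 and for large k, the level set at
height k contains all pairs (x, y) with y in a certain ball of radius proportional to (|D| / k)^(p/n), whose
measure times k^p is a constant multiple of |D|^p. Letting k tend to infinity, Fatou's lemma gives the claim.
\<close>

section \<open>Increments of functions of one variable\<close>

lemma lmeasurable_outer_open:
  assumes S: "S \<in> lmeasurable" and e: "e > 0"
  obtains T where "open T" "S \<subseteq> T" "T \<in> lmeasurable" "measure lebesgue T < measure lebesgue S + e"
proof -
  obtain T where T: "open T" "S \<subseteq> T" "T - S \<in> lmeasurable" "emeasure lebesgue (T - S) < ennreal e"
    using sets_lebesgue_outer_open[OF fmeasurableD[OF S] e] by blast
  have eq: "T = S \<union> (T - S)" using T by blast
  have "T \<in> lmeasurable" by (subst eq) (rule fmeasurable.Un[OF S T(3)])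
  moreover have "measure lebesgue (T - S) < e"
    using T(3,4) e by (simp add: emeasure_eq_measure2 ennreal_less_iff)
  moreover have "measure lebesgue T = measure lebesgue S + measure lebesgue (T - S)"
    using measure_Un2[OF S T(3)] eq by (metis Diff_idemp)
  ultimately show ?thesis using T that by simp
qed

text \<open>
The points outside E are those from which G later takes a smaller value, so they contribute nothing to the net
increase of G; on E the growth rate is at most \<theta>. This is a form of F. Riesz' rising sun lemma. In the
proof E is replaced by an open superset U of almost the same measure.
\<close>

lemma rising_sun_estimate:
  fixes G :: "real \<Rightarrow> real"
  assumes ab: "a \<le> b" and cont: "continuous_on {a..b} G"
    and th: "\<theta> \<ge> 0"
    and slope: "\<And>s t. a \<le> t \<Longrightarrow> t \<le> s \<Longrightarrow> s \<le> b \<Longrightarrow> G s - G t \<le> \<theta> * (s - t)"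
  defines "E \<equiv> {t\<in>{a..b}. \<forall>s\<in>{t..b}. G t \<le> G s}"
  shows "closed E" and "G b - G a \<le> \<theta> * measure lebesgue E"
proof -
  have E_eq: "E = {a..b} \<inter> (\<Inter>s\<in>{a..b}. {t\<in>{a..b}. G t \<le> G (max s t)})" (is "_ = ?R")
  proof (intro equalityI subsetI)
    fix t assume "t \<in> E"
    then show "t \<in> ?R" by (auto simp: E_def max_def)
  next
    fix t assume t: "t \<in> ?R"
    then have "G t \<le> G s" if "s \<in> {t..b}" for s
      using that by (auto simp: max_def dest!: bspec[where x=s] split: if_splits)
    with t show "t \<in> E" by (auto simp: E_def)
  qed
  have "closed {t\<in>{a..b}. G t \<le> G (max s t)}" if "s \<in> {a..b}" for s
    using that
    by (intro continuous_on_closed_Collect_le cont continuous_on_compose2[OF cont] continuous_intros)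
       auto
  then show clE: "closed E"
    unfolding E_eq by (intro closed_Int closed_INT) auto
  have "bounded E" by (rule bounded_subset[of "{a..b}"]) (auto simp: E_def)
  then have Em: "E \<in> lmeasurable"
    using clE by (intro lmeasurable_compact) (simp add: compact_eq_bounded_closed)
  show "G b - G a \<le> \<theta> * measure lebesgue E"
  proof (rule field_le_epsilon)
    fix e :: real assume e: "e > 0"
    define e' where "e' = e / (\<theta> + 1)"
    have e': "e' > 0" using e th by (simp add: e'_def)
    obtain U where U: "open U" "E \<subseteq> U" "U \<in> lmeasurable" "measure lebesgue U < measure lebesgue E + e'"
      using lmeasurable_outer_open[OF Em e'] by blast
    define H where "H t = measure lebesgue (U \<inter> {t..b})" for t
    have Um: "U \<inter> {t..s} \<in> lmeasurable" for t s
      using U(3) by (simp add: fmeasurable_Int_fmeasurable)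
    have H_split: "H t = measure lebesgue (U \<inter> {t..s}) + H s" if "t \<le> s" "s \<le> b" for t s
    proof -
      have "negligible ((U \<inter> {t..s}) \<inter> (U \<inter> {s..b}))"
        by (rule negligible_subset[of "{s}"]) auto
      then have "measure lebesgue ((U \<inter> {t..s}) \<union> (U \<inter> {s..b})) = measure lebesgue (U \<inter> {t..s}) + H s"
        unfolding H_def using measure_Un3[OF Um Um] negligible_imp_measure0 by simp
      moreover have "(U \<inter> {t..s}) \<union> (U \<inter> {s..b}) = U \<inter> {t..b}" using that by auto
      ultimately show ?thesis by (simp add: H_def)
    qed
    have len: "measure lebesgue (U \<inter> {t..s}) \<le> s - t" if "t \<le> s" for t s
    proof -
      have "measure lebesgue (U \<inter> {t..s}) \<le> measure lebesgue {t..s}"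
        by (rule measure_mono_fmeasurable) (use Um in \<open>auto simp: fmeasurableD\<close>)
      then show ?thesis using that by simp
    qed
    have H_cont: "continuous_on {a..b} H"
    proof -
      have "\<bar>H s - H t\<bar> \<le> \<bar>s - t\<bar>" if "s \<in> {a..b}" "t \<in> {a..b}" for s t
      proof (cases "s \<le> t")
        case True
        have "H s = measure lebesgue (U \<inter> {s..t}) + H t" "measure lebesgue (U \<inter> {s..t}) \<le> t - s"
          using H_split[of s t] len[of s t] True that by auto
        with True show ?thesis using measure_nonneg[of lebesgue "U \<inter> {s..t}"] by linarith
      next
        case False
        have "H t = measure lebesgue (U \<inter> {t..s}) + H s" "measure lebesgue (U \<inter> {t..s}) \<le> s - t"
          using H_split[of t s] len[of t s] False that by auto
        with False show ?thesis using measure_nonneg[of lebesgue "U \<inter> {t..s}"] by linarith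
      qed
      then have "1-lipschitz_on {a..b} H"
        by (auto simp: lipschitz_on_def dist_real_def)
      then show ?thesis by (rule lipschitz_on_continuous_on)
    qed
    define F where "F t = G t + \<theta> * H t" for t
    have F_cont: "continuous_on {a..b} F"
      unfolding F_def by (intro continuous_intros cont H_cont)
    have "F b \<le> F a"
    proof (rule ccontr)
      assume "\<not> F b \<le> F a"
      \<comment> \<open>F has a last minimiser t < b, but some later value of F is no larger: if t lies in U, the
        decrease of H just after t compensates the growth of G, and otherwise some later value of G is smaller.\<close>
      obtain m where m: "m \<in> {a..b}" "\<And>t. t \<in> {a..b} \<Longrightarrow> F m \<le> F t"
        using continuous_attains_inf[of "{a..b}" F] F_cont ab by auto
      define Z where "Z = {t\<in>{a..b}. F t = F m}"
      have "closed Z" unfolding Z_def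
        by (intro continuous_closed_preimage_constant F_cont) auto
      then have cZ: "compact Z" unfolding Z_def
        by (metis (no_types, lifting) Z_def bounded_closed_interval bounded_subset compact_eq_bounded_closed mem_Collect_eq subsetI)
      have "m \<in> Z" using m by (auto simp: Z_def)
      then obtain t where t: "t \<in> Z" "\<And>s. s \<in> Z \<Longrightarrow> s \<le> t"
        using compact_attains_sup[OF cZ] by auto
      have tab: "a \<le> t" "t \<le> b" and Ft: "F t = F m" using t(1) by (auto simp: Z_def)
      have tb: "t < b"
      proof (rule ccontr)
        assume "\<not> t < b"
        then have "F b = F m" using tab Ft by simp
        then show False using m(2)[of a] \<open>\<not> F b \<le> F a\<close> ab by auto
      qed
      have last: "F t < F s" if "t < s" "s \<le> b" for s
        using t(2)[of s] m(2)[of s] that tab Ft by (force simp: Z_def)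
      show False
      proof (cases "t \<in> U")
        case True
        then obtain d where d: "d > 0" "ball t d \<subseteq> U" using openE[OF U(1) True] by metis
        define s where "s = min b (t + d/2)"
        have s: "t < s" "s \<le> b" "{t..s} \<subseteq> U"
          using tb d by (auto simp: s_def dist_real_def subset_iff)
        have "H t = (s - t) + H s"
          using H_split[of t s] s by (simp add: Int_absorb1)
        then have "F s = G s - \<theta> * (s - t) + \<theta> * H t"
          by (simp add: F_def right_diff_distrib distrib_left)
        also have "\<dots> \<le> F t" using slope[of t s] s tab by (simp add: F_def)
        finally show False using last s by fastforce
      next
        case False
        then have "t \<notin> E" using U by auto
        then obtain s where s: "t \<le> s" "s \<le> b" "G s < G t" using tab by (auto simp: E_def not_le)
        have "H s \<le> H t" using H_split[of t s] s measure_nonneg[of lebesgue "U \<inter> {t..s}"] by simp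
        then have "F s < F t" using s th by (simp add: F_def add_less_le_mono mult_left_mono)
        then show False using last[of s] s by (cases "t = s") auto
      qed
    qed
    moreover have "H b = 0"
    proof -
      have "negligible (U \<inter> {b..b})" by (rule negligible_subset[of "{b}"]) auto
      then show ?thesis unfolding H_def by (rule negligible_imp_measure0)
    qed
    moreover have "H a \<le> measure lebesgue U" unfolding H_def
      by (rule measure_mono_fmeasurable) (use Um U in \<open>auto simp: fmeasurableD\<close>)
    ultimately have "G b - G a \<le> \<theta> * measure lebesgue U"
      using th by (simp add: F_def) (smt (verit) mult_left_mono)
    also have "\<dots> \<le> \<theta> * (measure lebesgue E + e')"
      using U(4) th by (intro mult_left_mono) auto
    also have "\<dots> \<le> \<theta> * measure lebesgue E + e"
      using e th by (simp add: e'_def field_simps)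
    finally show "G b - G a \<le> \<theta> * measure lebesgue E + e" .
  qed
qed

text \<open>
A mean value inequality without differentiability of g: the bound near each t, with an error \<epsilon>, is
additive over adjacent intervals, so it passes to the whole interval by compactness.
\<close>

lemma increment_le_of_local_bound:
  fixes g V v :: "real \<Rightarrow> real"
  assumes ab: "a \<le> b"
    and V: "\<And>t. a \<le> t \<Longrightarrow> t \<le> b \<Longrightarrow> (V has_real_derivative v t) (at t within {a..b})"
    and loc: "\<And>t \<epsilon>. a \<le> t \<Longrightarrow> t \<le> b \<Longrightarrow> \<epsilon> > 0 \<Longrightarrow>
       \<exists>d>0. \<forall>s\<in>{a..b}. \<bar>s - t\<bar> < d \<longrightarrow> \<bar>g s - g t\<bar> \<le> (v t + \<epsilon>) * \<bar>s - t\<bar>"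
  shows "\<bar>g b - g a\<bar> \<le> V b - V a"
proof (rule field_le_epsilon)
  fix e :: real assume e: "e > 0"
  define \<epsilon> where "\<epsilon> = e / (2 * (b - a + 1))"
  have eps: "\<epsilon> > 0" using e ab by (simp add: \<epsilon>_def)
  define P where "P u w \<longleftrightarrow> (a \<le> u \<and> w \<le> b \<longrightarrow> \<bar>g w - g u\<bar> \<le> V w - V u + 2 * \<epsilon> * (w - u))" for u w
  have "P a b"
  proof (rule Bolzano[OF ab])
    fix u w z assume "P u w" "P w z" "u \<le> w" "w \<le> z"
    then show "P u z" by (auto simp: P_def algebra_simps)
  next
    fix t assume t: "a \<le> t" "t \<le> b"
    obtain d1 where d1: "d1 > 0"
      "\<And>s. s \<in> {a..b} \<Longrightarrow> \<bar>s - t\<bar> < d1 \<Longrightarrow> \<bar>g s - g t\<bar> \<le> (v t + \<epsilon>) * \<bar>s - t\<bar>"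
      using loc[OF t eps] by auto
    have "((\<lambda>s. V s) has_derivative (\<lambda>h. v t * h)) (at t within {a..b})"
      using V[OF t] by (simp add: has_field_derivative_def)
    then obtain d2 where d2: "d2 > 0"
      "\<And>s. s \<in> {a..b} \<Longrightarrow> \<bar>s - t\<bar> < d2 \<Longrightarrow> \<bar>V s - V t - v t * (s - t)\<bar> \<le> \<epsilon> * \<bar>s - t\<bar>"
      unfolding has_derivative_within_alt using eps by (metis real_norm_def)
    show "\<exists>d>0. \<forall>u w. u \<le> t \<and> t \<le> w \<and> w - u < d \<longrightarrow> P u w"
    proof (intro exI[of _ "min d1 d2"] conjI allI impI)
      show "min d1 d2 > 0" using d1 d2 by simp
      fix u w assume uw: "u \<le> t \<and> t \<le> w \<and> w - u < min d1 d2"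
      show "P u w" unfolding P_def
      proof
        assume ab': "a \<le> u \<and> w \<le> b"
        have "\<bar>g u - g t\<bar> \<le> (v t + \<epsilon>) * (t - u)" "\<bar>g w - g t\<bar> \<le> (v t + \<epsilon>) * (w - t)"
          using d1(2)[of u] d1(2)[of w] uw ab' by auto
        moreover have "\<bar>V u - V t - v t * (u - t)\<bar> \<le> \<epsilon> * (t - u)" "\<bar>V w - V t - v t * (w - t)\<bar> \<le> \<epsilon> * (w - t)"
          using d2(2)[of u] d2(2)[of w] uw ab' by auto
        ultimately show "\<bar>g w - g u\<bar> \<le> V w - V u + 2 * \<epsilon> * (w - u)"
          by (simp add: algebra_simps)
      qed
    qed
  qed
  then have "\<bar>g b - g a\<bar> \<le> V b - V a + 2 * \<epsilon> * (b - a)" by (simp add: P_def)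
  also have "2 * \<epsilon> * (b - a) \<le> e" using e ab by (simp add: \<epsilon>_def field_simps)
  finally show "\<bar>g b - g a\<bar> \<le> V b - V a + e" by simp
qed

text \<open>
Subtracting the line of slope K - \<theta> turns g into a function with increments at most \<theta> times the length
that still rises by 7/8 of the largest possible amount. By the rising sun estimate, at least 7/8 of the points see no
smaller value to their right, and after reflection at least 7/8 see no larger value to their left.
Discarding both ends of length l/8 leaves half of the interval and room for steps of length l/8.
\<close>

lemma nearly_extremal_portion:
  fixes g :: "real \<Rightarrow> real"
  assumes l: "l > 0" and \<theta>: "\<theta> > 0"
    and lip: "\<And>s t. s \<in> {0..l} \<Longrightarrow> t \<in> {0..l} \<Longrightarrow> \<bar>g s - g t\<bar> \<le> K * \<bar>s - t\<bar>"
    and inc: "(K - \<theta> / 8) * l \<le> g l - g 0"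
  obtains T where "closed T" "T \<subseteq> {l/8..7*l/8}" "ennreal (l / 2) \<le> emeasure lborel T"
    "\<And>t s. t \<in> T \<Longrightarrow> 0 \<le> s \<Longrightarrow> s \<le> l / 8 \<Longrightarrow>
       (K - \<theta>) * s \<le> g (t + s) - g t \<and> (K - \<theta>) * s \<le> g t - g (t - s)"
proof -
  define G where "G t = g t - (K - \<theta>) * t" for t
  define G' where "G' t = - G (l - t)" for t
  have "K \<ge> 0" using lip[of 0 l] l by (simp add: zero_le_mult_iff) (smt (verit) mult_nonneg_nonneg mult_neg_pos)
  then have "K-lipschitz_on {0..l} g" using lip by (auto simp: lipschitz_on_def dist_real_def)
  then have gc: "continuous_on {0..l} g" by (rule lipschitz_on_continuous_on)
  have Gc: "continuous_on {0..l} G" unfolding G_def by (intro continuous_intros gc)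
  have G'c: "continuous_on {0..l} G'" unfolding G'_def
    by (intro continuous_intros continuous_on_compose2[OF Gc]) auto
  have slope: "G s - G t \<le> \<theta> * (s - t)" if "0 \<le> t" "t \<le> s" "s \<le> l" for s t
    using lip[of s t] that by (simp add: G_def algebra_simps)
  have slope': "G' s - G' t \<le> \<theta> * (s - t)" if "0 \<le> t" "t \<le> s" "s \<le> l" for s t
    using slope[of "l - s" "l - t"] that by (simp add: G'_def)
  define E where "E = {t\<in>{0..l}. \<forall>s\<in>{t..l}. G t \<le> G s}"
  define E' where "E' = {t\<in>{0..l}. \<forall>s\<in>{t..l}. G' t \<le> G' s}"
  define E2 where "E2 = (\<lambda>t. (-1) *\<^sub>R t + l) ` E'"
  have cE: "closed E" "closed E'"
    unfolding E_def E'_def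
    using rising_sun_estimate(1)[OF less_imp_le[OF l] Gc less_imp_le[OF \<theta>] slope]
      rising_sun_estimate(1)[OF less_imp_le[OF l] G'c less_imp_le[OF \<theta>] slope'] by blast+
  have bE: "bounded E" "bounded E'"
    by (rule bounded_subset[of "{0..l}"]; auto simp: E_def E'_def)+
  have "G l - G 0 \<le> \<theta> * measure lebesgue E" "G' l - G' 0 \<le> \<theta> * measure lebesgue E'"
    unfolding E_def E'_def
    using rising_sun_estimate(2)[OF less_imp_le[OF l] Gc less_imp_le[OF \<theta>] slope]
      rising_sun_estimate(2)[OF less_imp_le[OF l] G'c less_imp_le[OF \<theta>] slope'] by blast+
  moreover have "\<theta> * (7 / 8 * l) \<le> G l - G 0" "\<theta> * (7 / 8 * l) \<le> G' l - G' 0"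
    using inc by (simp_all add: G_def G'_def algebra_simps)
  ultimately have mE: "7 / 8 * l \<le> measure lebesgue E" "7 / 8 * l \<le> measure lebesgue E'"
    using \<theta> by (meson mult_le_cancel_left_pos order_trans)+
  have cE2: "compact E2" unfolding E2_def
    by (intro compact_continuous_image continuous_intros) (use cE bE in \<open>simp add: compact_eq_bounded_closed\<close>)
  have mE2: "7 / 8 * l \<le> measure lebesgue E2"
    unfolding E2_def using mE(2) by (simp only: measure_lebesgue_affine) simp
  have E2: "\<forall>s\<in>{0..t}. G s \<le> G t" "t \<in> {0..l}" if "t \<in> E2" for t
  proof -
    have t: "t \<in> {0..l}" "\<forall>s\<in>{l - t..l}. G' (l - t) \<le> G' s" using that by (auto simp: E2_def E'_def)
    show "t \<in> {0..l}" by fact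
    show "\<forall>s\<in>{0..t}. G s \<le> G t"
    proof
      fix s assume "s \<in> {0..t}"
      then have "l - s \<in> {l - t..l}" using t by auto
      with t(2) have "G' (l - t) \<le> G' (l - s)" by blast
      then show "G s \<le> G t" by (simp add: G'_def)
    qed
  qed
  define T where "T = E \<inter> E2 \<inter> {l/8..7*l/8}"
  have mb: "A \<in> lmeasurable" if "compact A" for A :: "real set" using that by (rule lmeasurable_compact)
  have Em: "E \<in> lmeasurable" "E2 \<in> lmeasurable" "{l/8..7*l/8} \<in> lmeasurable"
    using cE bE cE2 by (auto intro!: lmeasurable_compact simp: compact_eq_bounded_closed)
  have "E \<union> E2 \<union> {l/8..7*l/8} \<subseteq> {0..l}" using E2(2) l by (auto simp: E_def)
  have m1: "measure lebesgue (E \<union> E2) \<le> l"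
  proof -
    have "measure lebesgue (E \<union> E2) \<le> measure lebesgue {0..l}"
      using \<open>E \<union> E2 \<union> _ \<subseteq> _\<close> Em by (intro measure_mono_fmeasurable) auto
    then show ?thesis using l by simp
  qed
  have m2: "measure lebesgue ((E \<inter> E2) \<union> {l/8..7*l/8}) \<le> l"
  proof -
    have "measure lebesgue ((E \<inter> E2) \<union> {l/8..7*l/8}) \<le> measure lebesgue {0..l}"
      using \<open>E \<union> E2 \<union> _ \<subseteq> _\<close> Em by (intro measure_mono_fmeasurable) auto
    then show ?thesis using l by simp
  qed
  have "measure lebesgue (E \<union> E2) = measure lebesgue E + measure lebesgue E2 - measure lebesgue (E \<inter> E2)"
    by (rule measure_Un3) (use Em in auto)
  then have m3: "3 / 4 * l \<le> measure lebesgue (E \<inter> E2)" using mE mE2 m1 by simp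
  have "measure lebesgue ((E \<inter> E2) \<union> {l/8..7*l/8}) = measure lebesgue (E \<inter> E2) + measure lebesgue {l/8..7*l/8} - measure lebesgue T"
    unfolding T_def by (rule measure_Un3) (use Em in \<open>auto intro: fmeasurable.Int\<close>)
  moreover have "measure lebesgue {l/8..7*l/8} = 3 / 4 * l" using l by simp
  ultimately have mT: "l / 2 \<le> measure lebesgue T" using m2 m3 by linarith
  have cT: "compact T" unfolding T_def using cE cE2 by (intro compact_Int) (auto simp: compact_eq_bounded_closed bE)
  show ?thesis
  proof (rule that)
    show "closed T" using cT by (rule compact_imp_closed)
    show "T \<subseteq> {l/8..7*l/8}" by (simp add: T_def)
    have "ennreal (l / 2) \<le> ennreal (measure lebesgue T)" using mT by (rule ennreal_leI)
    also have "\<dots> = emeasure lebesgue T" using mb[OF cT] by (simp add: emeasure_eq_measure2)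
    also have "\<dots> = emeasure lborel T" using cT by (simp add: compact_imp_closed borel_closed)
    finally show "ennreal (l / 2) \<le> emeasure lborel T" .
    fix t s assume ts: "t \<in> T" "0 \<le> s" "s \<le> l / 8"
    then have "t \<in> E" "t \<in> E2" "t \<in> {l/8..7*l/8}" by (auto simp: T_def)
    then have "G t \<le> G (t + s)" "G (t - s) \<le> G t" using ts E2[of t] by (auto simp: E_def)
    then show "(K - \<theta>) * s \<le> g (t + s) - g t \<and> (K - \<theta>) * s \<le> g t - g (t - s)"
      by (simp add: G_def algebra_simps)
  qed
qed

section \<open>Sets with a proportionally large hole in small balls\<close>

text \<open>
Given an open superset U of N, cover N up to a null set by disjoint balls inside U and remove from each ball
the part known to miss N. What remains still covers N almost everywhere, and its measure is smaller than that
of U by a fixed factor; iterating drives the outer measure of N to 0. Open supersets stand in for the outer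
measure, since N may fail to be measurable.
\<close>

lemma negligible_of_porous:
  fixes N :: "'a::euclidean_space set"
  assumes bdd: "bounded N" and k: "\<kappa> > 0"
    and por: "\<And>x d. x \<in> N \<Longrightarrow> d > 0 \<Longrightarrow> \<exists>r G. 0 < r \<and> r < d \<and> G \<subseteq> ball x r \<and> G \<inter> N = {} \<and>
        G \<in> lmeasurable \<and> \<kappa> * measure lebesgue (ball x r) \<le> measure lebesgue G"
  shows "negligible N"
proof -
  define \<kappa>' where "\<kappa>' = min \<kappa> 1"
  have k': "0 < \<kappa>'" "\<kappa>' \<le> 1" "\<kappa>' \<le> \<kappa>" using k by (auto simp: \<kappa>'_def)
  \<comment> \<open>One step removes the proportion \<kappa>'; half of this gain is spent on passing to an open superset.\<close>
  define q where "q = 1 - \<kappa>' / 2"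
  have q: "0 < q" "q < 1" using k' by (auto simp: q_def)
  have step: "\<exists>U'. open U' \<and> N \<subseteq> U' \<and> U' \<in> lmeasurable \<and> measure lebesgue U' \<le> q * m"
    if U: "open U" "N \<subseteq> U" "U \<in> lmeasurable" and m: "measure lebesgue U \<le> m" "m > 0" for U m
  proof -
    define K where "K = {(x, r, G). x \<in> N \<and> 0 < r \<and> ball x r \<subseteq> U \<and> G \<subseteq> ball x r \<and> G \<inter> N = {} \<and>
        G \<in> lmeasurable \<and> \<kappa> * measure lebesgue (ball x r) \<le> measure lebesgue G}"
    have "\<exists>i. i \<in> K \<and> x \<in> ball (fst i) (fst (snd i)) \<and> fst (snd i) < d" if xd: "x \<in> N" "0 < d" for x d
    proof -
      obtain d' where d': "d' > 0" "ball x d' \<subseteq> U"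
        using openE[OF U(1) subsetD[OF U(2) xd(1)]] by metis
      obtain r G where rG: "0 < r" "r < min d d'" "G \<subseteq> ball x r" "G \<inter> N = {}"
        "G \<in> lmeasurable" "\<kappa> * measure lebesgue (ball x r) \<le> measure lebesgue G"
        using por[OF xd(1), of "min d d'"] xd(2) d'(1) min_less_iff_conj by metis
      have "ball x r \<subseteq> ball x d'" using rG by (intro subset_ball) simp
      with d' have "ball x r \<subseteq> U" by blast
      with xd rG have "(x, r, G) \<in> K" by (simp add: K_def)
      with rG show ?thesis by (intro exI[of _ "(x, r, G)"]) simp
    qed
    then obtain C where C: "countable C" "C \<subseteq> K"
      "pairwise (\<lambda>i j. disjnt (ball (fst i) (fst (snd i))) (ball (fst j) (fst (snd j)))) C"
      "negligible (N - (\<Union>i\<in>C. ball (fst i) (fst (snd i))))"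
      by (rule Vitali_covering_theorem_balls)
    define B where "B i = ball (fst i) (fst (snd i))" for i :: "'a \<times> real \<times> 'a set"
    define GG where "GG = (\<lambda>i :: 'a \<times> real \<times> 'a set. snd (snd i))"
    have Cprop: "B i \<subseteq> U" "GG i \<subseteq> B i" "GG i \<inter> N = {}" "GG i \<in> lmeasurable" "B i \<in> lmeasurable"
       "\<kappa> * measure lebesgue (B i) \<le> measure lebesgue (GG i)" if "i \<in> C" for i
    proof -
      obtain x r G where i: "i = (x, r, G)" by (cases i) blast
      have "(x, r, G) \<in> K" using C(2) that i by blast
      then have P: "ball x r \<subseteq> U" "G \<subseteq> ball x r" "G \<inter> N = {}" "G \<in> lmeasurable"
        "\<kappa> * measure lebesgue (ball x r) \<le> measure lebesgue G"
        unfolding K_def mem_Collect_eq prod.case by argo+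
      have eqs: "B i = ball x r" "GG i = G" by (simp_all add: i B_def GG_def)
      show "B i \<subseteq> U" "GG i \<subseteq> B i" "GG i \<inter> N = {}" "GG i \<in> lmeasurable" "B i \<in> lmeasurable"
        "\<kappa> * measure lebesgue (B i) \<le> measure lebesgue (GG i)"
        unfolding eqs by (rule P lmeasurable_ball)+
    qed
    define R where "R i = B i - GG i" for i
    have R: "R i \<in> lmeasurable" "measure lebesgue (R i) \<le> (1 - \<kappa>') * measure lebesgue (B i)" if "i \<in> C" for i
    proof -
      show "R i \<in> lmeasurable" unfolding R_def using Cprop[OF that] by (intro fmeasurable_Diff) (auto simp: fmeasurableD)
      have "measure lebesgue (R i) = measure lebesgue (B i) - measure lebesgue (GG i)"
        unfolding R_def using Cprop[OF that] by (intro measurable_measure_Diff) (auto simp: fmeasurableD)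
      moreover have "\<kappa>' * measure lebesgue (B i) \<le> \<kappa> * measure lebesgue (B i)"
        using k' by (intro mult_right_mono) auto
      ultimately show "measure lebesgue (R i) \<le> (1 - \<kappa>') * measure lebesgue (B i)"
        using Cprop(6)[OF that] by (simp add: algebra_simps)
    qed
    have fin: "measure lebesgue (\<Union>i\<in>I. R i) \<le> (1 - \<kappa>') * m" if I: "I \<subseteq> C" "finite I" for I
    proof -
      have "measure lebesgue (\<Union>i\<in>I. R i) \<le> (\<Sum>i\<in>I. measure lebesgue (R i))"
        using I R by (intro measure_UNION_le) (auto simp: fmeasurableD)
      also have "\<dots> \<le> (\<Sum>i\<in>I. (1 - \<kappa>') * measure lebesgue (B i))"
        using I R by (intro sum_mono) auto
      also have "\<dots> = (1 - \<kappa>') * (\<Sum>i\<in>I. measure lebesgue (B i))" by (simp add: sum_distrib_left)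
      also have "(\<Sum>i\<in>I. measure lebesgue (B i)) = measure lebesgue (\<Union>i\<in>I. B i)"
      proof (rule measure_finite_Union[symmetric, OF I(2)])
        show "B ` I \<subseteq> sets lebesgue" by (auto simp: B_def)
        show "disjoint_family_on B I"
          unfolding disjoint_family_on_def B_def
          using pairwiseD[OF C(3), unfolded disjnt_def] subsetD[OF I(1)] by blast
        show "emeasure lebesgue (B i) \<noteq> \<infinity>" for i
          unfolding B_def using fmeasurableD2[OF lmeasurable_ball] by (metis infinity_ennreal_def)
      qed
      also have "(1 - \<kappa>') * measure lebesgue (\<Union>i\<in>I. B i) \<le> (1 - \<kappa>') * m"
      proof -
        have "measure lebesgue (\<Union>i\<in>I. B i) \<le> measure lebesgue U"
        proof (rule measure_mono_fmeasurable[OF _ _ U(3)])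
          show "(\<Union>i\<in>I. B i) \<subseteq> U" using Cprop(1) I(1) by blast
          show "(\<Union>i\<in>I. B i) \<in> sets lebesgue"
            by (rule sets.finite_UN[OF I(2)]) (simp add: B_def)
        qed
        then show ?thesis using m k' by (intro mult_left_mono) auto
      qed
      finally show ?thesis .
    qed
    define W where "W = (\<Union>i\<in>C. R i)"
    have W: "W \<in> lmeasurable" "measure lebesgue W \<le> (1 - \<kappa>') * m"
      unfolding W_def
      by (rule fmeasurable_UN_bound[OF C(1) R(1) fin] measure_UN_bound[OF C(1) R(1) fin]; assumption)+
    define Z where "Z = N - (\<Union>i\<in>C. B i)"
    have Z: "negligible Z" using C(4) by (simp add: Z_def B_def)
    have "N \<subseteq> Z \<union> W" using Cprop(3) unfolding Z_def W_def R_def by blast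
    have ZW: "Z \<union> W \<in> lmeasurable" using Z W by (simp add: negligible_imp_measurable fmeasurable.Un)
    have "measure lebesgue (Z \<union> W) \<le> (1 - \<kappa>') * m"
      using measure_Un_null_set[OF fmeasurableD[OF W(1)], of Z] Z W
      by (simp add: negligible_iff_null_sets Un_commute)
    moreover have "\<kappa>' / 2 * m > 0" using k' m by simp
    ultimately obtain U' where U': "open U'" "Z \<union> W \<subseteq> U'" "U' \<in> lmeasurable" "measure lebesgue U' < measure lebesgue (Z \<union> W) + \<kappa>' / 2 * m"
      using lmeasurable_outer_open[OF ZW] by blast
    show ?thesis
      using U' \<open>N \<subseteq> Z \<union> W\<close> \<open>measure lebesgue (Z \<union> W) \<le> (1 - \<kappa>') * m\<close>
      by (intro exI[of _ U']) (auto simp: q_def algebra_simps)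
  qed
  obtain R where R: "N \<subseteq> ball 0 R" "R > 0" using bounded_subset_ballD[OF bdd, of 0] by blast
  define m0 where "m0 = measure lebesgue (ball (0::'a) R)"
  have m0: "m0 > 0" using R by (simp add: m0_def content_ball_pos)
  have it: "\<exists>U. open U \<and> N \<subseteq> U \<and> U \<in> lmeasurable \<and> measure lebesgue U \<le> q ^ k * m0" for k
  proof (induction k)
    case 0
    then show ?case using R by (intro exI[of _ "ball 0 R"]) (auto simp: m0_def)
  next
    case (Suc k)
    then show ?case using step[of _ "q ^ k * m0"] q m0 by (auto simp: mult.assoc)
  qed
  show ?thesis unfolding negligible_outer_le
  proof (intro allI impI)
    fix e :: real assume e: "e > 0"
    obtain k where "q ^ k < e / m0" using real_arch_pow_inv[of "e / m0" q] e m0 q by auto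
    then have "q ^ k * m0 \<le> e" using m0 by (simp add: field_simps)
    then show "\<exists>T. N \<subseteq> T \<and> T \<in> lmeasurable \<and> measure lebesgue T \<le> e"
      using it[of k] by (meson order_trans)
  qed
qed

section \<open>Affine approximation\<close>

text \<open>
This quantifies how flat the cone |s e - \<cdot>| is near the origin: to first order in h it is s - e \<bullet> h, with a
quadratic error.
\<close>

lemma norm_scaled_unit_diff_le:
  fixes e h :: "'a::real_inner"
  assumes e: "norm e = 1" and s: "s > 0" "2 * norm h \<le> s"
  shows "norm (s *\<^sub>R e - h) \<le> s - e \<bullet> h + (norm h)\<^sup>2 / s"
proof (rule power2_le_imp_le)
  define q w where "q = e \<bullet> h" and "w = (norm h)\<^sup>2"
  have "\<bar>q\<bar> \<le> norm h" using Cauchy_Schwarz_ineq2[of e h] e by (simp add: q_def)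
  then have a: "s / 2 \<le> s - q" using s by linarith
  have w0: "w \<ge> 0" by (simp add: w_def)
  have ee: "e \<bullet> e = 1" using e by (simp add: norm_eq_1)
  have "(norm (s *\<^sub>R e - h))\<^sup>2 = s\<^sup>2 - 2 * s * q + w"
    unfolding power2_norm_eq_inner w_def q_def
    by (simp add: inner_diff_left inner_diff_right ee inner_commute power2_eq_square algebra_simps)
  also have "\<dots> \<le> (s - q)\<^sup>2 + w" by (simp add: power2_diff)
  also have "w = s / 2 * (2 * w / s)" using s by simp
  also have "s / 2 * (2 * w / s) \<le> (s - q) * (2 * w / s)" using a w0 s by (intro mult_right_mono) auto
  also have "(s - q)\<^sup>2 + (s - q) * (2 * w / s) \<le> (s - q + w / s)\<^sup>2"
  proof -
    have "(s - q) * (2 * w / s) = 2 * (s - q) * (w / s)" by simp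
    then show ?thesis using zero_le_power2[of "w / s"] by (simp only: power2_sum)
  qed
  finally show "(norm (s *\<^sub>R e - h))\<^sup>2 \<le> (s - e \<bullet> h + (norm h)\<^sup>2 / s)\<^sup>2"
    by (simp add: q_def w_def)
  show "0 \<le> s - e \<bullet> h + (norm h)\<^sup>2 / s"
    using a s w0 by (simp add: q_def w_def add_nonneg_nonneg)
qed

text \<open>
Since f is K-Lipschitz, its value at z + h is bounded below by a cone with apex z + s e, and above by a cone with
apex z - s e, and along the direction e these apices are as high and as low as K permits, up to \<theta> s. Far away from
the apex (s = M |h|) both cones are almost the affine function with gradient K e; the constant M balances the
error \<theta> M of the apex values against the curvature error K / M.
\<close>

lemma affine_of_extremal_direction:
  fixes f :: "'a::real_inner \<Rightarrow> real"
  assumes e: "norm e = 1" and K: "K \<ge> 0" and \<theta>: "\<theta> \<ge> 0" and M: "M \<ge> 2" and \<sigma>: "\<sigma> > 0"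
    and lip: "\<And>y y'. dist z y \<le> \<sigma> \<Longrightarrow> dist z y' \<le> \<sigma> \<Longrightarrow> \<bar>f y - f y'\<bar> \<le> K * norm (y - y')"
    and fwd: "\<And>s. 0 \<le> s \<Longrightarrow> s \<le> \<sigma> \<Longrightarrow> (K - \<theta>) * s \<le> f (z + s *\<^sub>R e) - f z"
    and bwd: "\<And>s. 0 \<le> s \<Longrightarrow> s \<le> \<sigma> \<Longrightarrow> (K - \<theta>) * s \<le> f z - f (z - s *\<^sub>R e)"
    and h: "M * norm h \<le> \<sigma>"
  shows "\<bar>f (z + h) - f z - (K *\<^sub>R e) \<bullet> h\<bar> \<le> (\<theta> * M + K / M) * norm h"
proof (cases "h = 0")
  case False
  define s where "s = M * norm h"
  have s: "s > 0" "2 * norm h \<le> s" "s \<le> \<sigma>"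
    using False M h by (auto simp: s_def intro: mult_right_mono)
  have hs: "norm h \<le> \<sigma>" using s norm_ge_zero[of h] by linarith
  have sq: "(norm h)\<^sup>2 / s = norm h / M" using False by (simp add: s_def power2_eq_square)
  have 1: "norm (s *\<^sub>R e - h) \<le> s - e \<bullet> h + norm h / M"
    using norm_scaled_unit_diff_le[OF e s(1,2)] sq by simp
  have 2: "norm (s *\<^sub>R e + h) \<le> s + e \<bullet> h + norm h / M"
    using norm_scaled_unit_diff_le[OF e s(1), of "- h"] s(2) sq by simp
  have "\<bar>f (z + s *\<^sub>R e) - f (z + h)\<bar> \<le> K * norm (s *\<^sub>R e - h)"
    using lip[of "z + s *\<^sub>R e" "z + h"] s hs e by (simp add: dist_norm)
  also have "\<dots> \<le> K * (s - e \<bullet> h + norm h / M)" using 1 K by (rule mult_left_mono)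
  finally have A: "f (z + s *\<^sub>R e) - f (z + h) \<le> K * (s - e \<bullet> h + norm h / M)" by linarith
  have "\<bar>f (z + h) - f (z - s *\<^sub>R e)\<bar> \<le> K * norm (s *\<^sub>R e + h)"
    using lip[of "z + h" "z - s *\<^sub>R e"] s hs e by (simp add: dist_norm add.commute)
  also have "\<dots> \<le> K * (s + e \<bullet> h + norm h / M)" using 2 K by (rule mult_left_mono)
  finally have B: "f (z + h) - f (z - s *\<^sub>R e) \<le> K * (s + e \<bullet> h + norm h / M)" by linarith
  have F: "(K - \<theta>) * s \<le> f (z + s *\<^sub>R e) - f z" and W: "(K - \<theta>) * s \<le> f z - f (z - s *\<^sub>R e)"
    using fwd[of s] bwd[of s] s by auto
  have eq: "(\<theta> * M + K / M) * norm h = \<theta> * s + K * (norm h / M)" by (simp add: s_def algebra_simps)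
  show ?thesis unfolding eq abs_le_iff
    using A B F W by (simp add: algebra_simps)
qed simp

text \<open>
The slope a may depend on \<epsilon>. Two slopes that both serve on a common ball differ by at most the sum of
their tolerances, so the slopes for \<epsilon> = 1/(k+1) form a Cauchy sequence whose limit is the gradient.
\<close>

lemma differentiable_of_affine_approximations:
  fixes f :: "'a::euclidean_space \<Rightarrow> real"
  assumes approx: "\<And>\<epsilon>. \<epsilon> > 0 \<Longrightarrow> \<exists>a \<delta>. \<delta> > 0 \<and> (\<forall>h. norm h \<le> \<delta> \<longrightarrow> \<bar>f (x + h) - f x - a \<bullet> h\<bar> \<le> \<epsilon> * norm h)"
  shows "f differentiable (at x)"
proof -
  have "\<exists>a \<delta>. \<delta> > 0 \<and> (\<forall>h. norm h \<le> \<delta> \<longrightarrow> \<bar>f (x + h) - f x - a \<bullet> h\<bar> \<le> 1 / Suc k * norm h)" for k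
    by (rule approx) simp
  then obtain a \<delta> where \<delta>: "\<And>k. \<delta> k > 0"
    and a: "\<And>k h. norm h \<le> \<delta> k \<Longrightarrow> \<bar>f (x + h) - f x - a k \<bullet> h\<bar> \<le> 1 / Suc k * norm h"
    by metis
  have dist_a: "norm (a j - a k) \<le> 1 / Suc j + 1 / Suc k" for j k
  proof (cases "a j = a k")
    case False
    define v where "v = a j - a k"
    define t where "t = min (\<delta> j) (\<delta> k) / norm v"
    have v: "norm v > 0" using False by (simp add: v_def)
    have t: "t > 0" using v \<delta> by (simp add: t_def)
    have nt: "norm (t *\<^sub>R v) = min (\<delta> j) (\<delta> k)" using v t \<delta>[of j] \<delta>[of k] by (simp add: t_def)
    have le: "norm (t *\<^sub>R v) \<le> \<delta> j" "norm (t *\<^sub>R v) \<le> \<delta> k" by (simp_all only: nt min.cobounded1 min.cobounded2)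
    have "\<bar>f (x + t *\<^sub>R v) - f x - a j \<bullet> (t *\<^sub>R v)\<bar> \<le> 1 / Suc j * norm (t *\<^sub>R v)"
      "\<bar>f (x + t *\<^sub>R v) - f x - a k \<bullet> (t *\<^sub>R v)\<bar> \<le> 1 / Suc k * norm (t *\<^sub>R v)"
      by (rule a[OF le(1)] a[OF le(2)])+
    then have "\<bar>v \<bullet> (t *\<^sub>R v)\<bar> \<le> (1 / Suc j + 1 / Suc k) * norm (t *\<^sub>R v)"
      by (simp only: v_def inner_diff_left distrib_right)
    moreover have "\<bar>v \<bullet> (t *\<^sub>R v)\<bar> = norm v * norm (t *\<^sub>R v)"
      using t by (simp add: abs_mult power2_norm_eq_inner[symmetric] power2_eq_square)
    ultimately have "norm v * norm (t *\<^sub>R v) \<le> (1 / Suc j + 1 / Suc k) * norm (t *\<^sub>R v)" by simp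
    moreover have "norm (t *\<^sub>R v) > 0" using t v by simp
    ultimately show ?thesis unfolding v_def[symmetric] by (rule mult_right_le_imp_le)
  qed simp
  have "Cauchy a"
  proof (rule CauchyI)
    fix e :: real assume "e > 0"
    then obtain N where N: "inverse (real (Suc N)) < e / 2" using reals_Archimedean[of "e / 2"] by auto
    have "1 / Suc j < e / 2" if "j \<ge> N" for j
    proof -
      have "1 / real (Suc j) \<le> inverse (real (Suc N))" using that by (simp add: field_simps)
      with N show ?thesis by linarith
    qed
    note small = this
    have "norm (a j - a k) < e" if "j \<ge> N" "k \<ge> N" for j k
      using dist_a[of j k] small[OF that(1)] small[OF that(2)] by linarith
    then show "\<exists>N. \<forall>j\<ge>N. \<forall>k\<ge>N. norm (a j - a k) < e" by blast
  qed
  then obtain A where A: "a \<longlonglongrightarrow> A" using Cauchy_convergent_iff convergent_def by blast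
  have "(f has_derivative (\<lambda>h. A \<bullet> h)) (at x)"
    unfolding has_derivative_at_alt
  proof (intro conjI allI impI)
    show "bounded_linear (\<lambda>h. A \<bullet> h)" by (rule bounded_linear_inner_right)
    fix e :: real assume e: "e > 0"
    obtain N where N: "inverse (real (Suc N)) < e / 2" using reals_Archimedean[of "e / 2"] e by auto
    have "eventually (\<lambda>k. dist (a k) A < e / 2) sequentially"
      using A e by (intro tendstoD) auto
    then obtain N2 where N2: "\<And>k. k \<ge> N2 \<Longrightarrow> dist (a k) A < e / 2" by (auto simp: eventually_sequentially)
    define k where "k = max N N2"
    have k1: "1 / Suc k \<le> e / 2"
    proof -
      have "1 / real (Suc k) \<le> inverse (real (Suc N))" by (simp add: k_def field_simps)
      with N show ?thesis by linarith
    qed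
    have k2: "norm (a k - A) \<le> e / 2" using N2[of k] by (simp add: k_def dist_norm)
    show "\<exists>d>0. \<forall>y. norm (y - x) < d \<longrightarrow> norm (f y - f x - A \<bullet> (y - x)) \<le> e * norm (y - x)"
    proof (intro exI[of _ "\<delta> k"] conjI allI impI \<delta>)
      fix y assume y: "norm (y - x) < \<delta> k"
      have "\<bar>f y - f x - a k \<bullet> (y - x)\<bar> \<le> 1 / Suc k * norm (y - x)"
        using a[of "y - x" k] y by simp
      also have "\<dots> \<le> e / 2 * norm (y - x)" using k1 by (rule mult_right_mono) simp
      finally have "\<bar>f y - f x - a k \<bullet> (y - x)\<bar> \<le> e / 2 * norm (y - x)" .
      moreover have "\<bar>(a k - A) \<bullet> (y - x)\<bar> \<le> e / 2 * norm (y - x)"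
        using Cauchy_Schwarz_ineq2[of "a k - A" "y - x"] k2
        by (meson mult_right_mono norm_ge_zero order_trans)
      ultimately show "norm (f y - f x - A \<bullet> (y - x)) \<le> e * norm (y - x)"
        unfolding inner_diff_left real_norm_def by linarith
    qed
  qed
  then show ?thesis by (rule differentiableI)
qed

section \<open>Averaging over dilations and translations\<close>

lemma nn_integral_lborel_scale:
  fixes f :: "'a::euclidean_space \<Rightarrow> ennreal"
  assumes [measurable]: "f \<in> borel_measurable borel" and c: "c > 0"
  shows "(\<integral>\<^sup>+x. f x \<partial>lborel) = ennreal (c ^ DIM('a)) * (\<integral>\<^sup>+x. f (c *\<^sub>R x) \<partial>lborel)"
  using c by (subst lborel_affine[of c 0])
     (simp_all add: nn_integral_density nn_integral_distr nn_integral_cmult)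

lemma nn_integral_lborel_translate:
  fixes f :: "'a::euclidean_space \<Rightarrow> ennreal"
  assumes [measurable]: "f \<in> borel_measurable borel"
  shows "(\<integral>\<^sup>+x. f (x + a) \<partial>lborel) = (\<integral>\<^sup>+x. f x \<partial>lborel)"
proof -
  have "(\<integral>\<^sup>+x. f x \<partial>lborel) = (\<integral>\<^sup>+x. f x \<partial>distr lborel borel ((+) a))"
    by (simp only: lborel_distr_plus)
  also have "\<dots> = (\<integral>\<^sup>+x. f (x + a) \<partial>lborel)"
    by (simp add: nn_integral_distr add.commute)
  finally show ?thesis ..
qed

text \<open>
A substitute for polar coordinates: the unit sphere is replaced by the shell 1 \<le> |h| \<le> 2. Each k is \<sigma> h with h in the
shell exactly for \<sigma> between |k|/2 and |k|, and the weight d\<sigma>/\<sigma> of this range is at least 1/2.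
\<close>

lemma nn_integral_le_radial:
  fixes G :: "'a::euclidean_space \<Rightarrow> ennreal"
  assumes [measurable]: "G \<in> borel_measurable borel" and m: "DIM('a) = Suc m"
  shows "(\<integral>\<^sup>+k. G k \<partial>lborel) \<le>
     ennreal 2 * (\<integral>\<^sup>+h. \<integral>\<^sup>+\<sigma>. indicator {1..2} (norm h) * (ennreal (\<sigma> ^ m) * indicator {0<..} \<sigma> * G (\<sigma> *\<^sub>R h)) \<partial>lborel \<partial>lborel)"
proof -
  have two: "ennreal 2 * ennreal (1/2) = 1" by (subst ennreal_mult[symmetric]) simp_all
  have double: "(\<integral>\<^sup>+k. G k \<partial>lborel) = ennreal 2 * (\<integral>\<^sup>+k. ennreal (1/2) * G k \<partial>lborel)"
    by (subst nn_integral_cmult) (simp_all only: mult.assoc[symmetric] two, simp_all)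
  have "(\<integral>\<^sup>+k. ennreal (1/2) * G k \<partial>lborel) \<le>
     (\<integral>\<^sup>+k. (\<integral>\<^sup>+\<sigma>. indicator {0<..} \<sigma> * ennreal (1 / \<sigma>) * indicator {1..2} (norm k / \<sigma>) \<partial>lborel) * G k \<partial>lborel)"
  proof (rule nn_integral_mono_AE)
    have "AE k in lborel. k \<noteq> (0::'a)" by (rule AE_lborel_singleton)
    then show "AE k in lborel. ennreal (1/2) * G k \<le> (\<integral>\<^sup>+\<sigma>. indicator {0<..} \<sigma> * ennreal (1 / \<sigma>) * indicator {1..2} (norm k / \<sigma>) \<partial>lborel) * G k"
    proof eventually_elim
      case (elim k)
      then have k: "norm k > 0" by simp
      have "ennreal (1/2) = ennreal (1 / norm k) * ennreal (norm k / 2)"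
        using k by (simp add: ennreal_mult[symmetric])
      also have "\<dots> = (\<integral>\<^sup>+\<sigma>. ennreal (1 / norm k) * indicator {norm k / 2..norm k} \<sigma> \<partial>lborel)"
        using k by (subst nn_integral_cmult_indicator) (simp_all add: field_simps)
      also have "\<dots> \<le> (\<integral>\<^sup>+\<sigma>. indicator {0<..} \<sigma> * ennreal (1 / \<sigma>) * indicator {1..2} (norm k / \<sigma>) \<partial>lborel)"
      proof (intro nn_integral_mono)
        fix \<sigma> :: real
        show "ennreal (1 / norm k) * indicator {norm k / 2..norm k} \<sigma>
          \<le> indicator {0<..} \<sigma> * ennreal (1 / \<sigma>) * indicator {1..2} (norm k / \<sigma>)"
        proof (cases "\<sigma> \<in> {norm k / 2..norm k}")
          case True
          then have "norm k / 2 \<le> \<sigma>" by simp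
          with k have "\<sigma> > 0" by linarith
          moreover have "norm k / \<sigma> \<in> {1..2}" "1 / norm k \<le> 1 / \<sigma>"
            using True k \<open>\<sigma> > 0\<close> by (auto simp: field_simps)
          ultimately show ?thesis using True by (simp add: ennreal_leI)
        qed simp
      qed
      finally show ?case by (rule mult_right_mono) simp
    qed
  qed
  also have "\<dots> = (\<integral>\<^sup>+k. \<integral>\<^sup>+\<sigma>. indicator {0<..} \<sigma> * ennreal (1 / \<sigma>) * indicator {1..2} (norm k / \<sigma>) * G k \<partial>lborel \<partial>lborel)"
    by (intro nn_integral_cong nn_integral_multc[symmetric]) simp
  also have "\<dots> = (\<integral>\<^sup>+\<sigma>. \<integral>\<^sup>+k. indicator {0<..} \<sigma> * ennreal (1 / \<sigma>) * indicator {1..2} (norm k / \<sigma>) * G k \<partial>lborel \<partial>lborel)"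
    by (rule lborel_pair.Fubini') simp
  also have "\<dots> = (\<integral>\<^sup>+\<sigma>. \<integral>\<^sup>+h. indicator {1..2} (norm h) * (ennreal (\<sigma> ^ m) * indicator {0<..} \<sigma> * G (\<sigma> *\<^sub>R h)) \<partial>lborel \<partial>lborel)"
  proof (rule nn_integral_cong)
    fix \<sigma> :: real
    show "(\<integral>\<^sup>+k. indicator {0<..} \<sigma> * ennreal (1 / \<sigma>) * indicator {1..2} (norm k / \<sigma>) * G k \<partial>lborel)
        = (\<integral>\<^sup>+h. indicator {1..2} (norm h) * (ennreal (\<sigma> ^ m) * indicator {0<..} \<sigma> * G (\<sigma> *\<^sub>R h)) \<partial>lborel)"
    proof (cases "\<sigma> > 0")
      case True
      have "(\<integral>\<^sup>+k. indicator {0<..} \<sigma> * ennreal (1 / \<sigma>) * indicator {1..2} (norm k / \<sigma>) * G k \<partial>lborel)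
        = ennreal (\<sigma> ^ Suc m) * (\<integral>\<^sup>+h. indicator {0<..} \<sigma> * ennreal (1 / \<sigma>) * indicator {1..2} (norm (\<sigma> *\<^sub>R h) / \<sigma>) * G (\<sigma> *\<^sub>R h) \<partial>lborel)"
        by (subst nn_integral_lborel_scale[OF _ True]) (simp_all add: m)
      also have "\<dots> = (\<integral>\<^sup>+h. ennreal (\<sigma> ^ Suc m) * (indicator {0<..} \<sigma> * ennreal (1 / \<sigma>) * indicator {1..2} (norm (\<sigma> *\<^sub>R h) / \<sigma>) * G (\<sigma> *\<^sub>R h)) \<partial>lborel)"
        by (rule nn_integral_cmult[symmetric]) simp
      also have "\<dots> = (\<integral>\<^sup>+h. indicator {1..2} (norm h) * (ennreal (\<sigma> ^ m) * indicator {0<..} \<sigma> * G (\<sigma> *\<^sub>R h)) \<partial>lborel)"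
      proof (intro nn_integral_cong)
        fix h :: 'a
        have "ennreal (\<sigma> ^ Suc m) * ennreal (1 / \<sigma>) = ennreal (\<sigma> ^ m)"
          using True by (simp add: ennreal_mult[symmetric])
        then show "ennreal (\<sigma> ^ Suc m) * (indicator {0<..} \<sigma> * ennreal (1 / \<sigma>) * indicator {1..2} (norm (\<sigma> *\<^sub>R h) / \<sigma>) * G (\<sigma> *\<^sub>R h))
          = indicator {1..2} (norm h) * (ennreal (\<sigma> ^ m) * indicator {0<..} \<sigma> * G (\<sigma> *\<^sub>R h))"
          using True by (simp add: indicator_def mult.assoc[symmetric])
      qed
      finally show ?thesis .
    qed simp
  qed
  also have "\<dots> = (\<integral>\<^sup>+h. \<integral>\<^sup>+\<sigma>. indicator {1..2} (norm h) * (ennreal (\<sigma> ^ m) * indicator {0<..} \<sigma> * G (\<sigma> *\<^sub>R h)) \<partial>lborel \<partial>lborel)"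
    by (rule lborel_pair.Fubini') simp
  finally show ?thesis unfolding double by (rule mult_left_mono) simp
qed

text \<open>
Fubini's theorem in an arbitrary direction e without rotating coordinates: the measure of G is the average over
t in [0, l] of the measures of its translates by t e, which are all equal.
\<close>

lemma measure_ge_of_parallel_segments:
  fixes G D :: "'a::euclidean_space set"
  assumes [measurable]: "G \<in> sets borel" "D \<in> sets borel" and l: "l > 0"
    and seg: "\<And>w. w \<in> D \<Longrightarrow> ennreal (l / 2) \<le> emeasure lborel {t\<in>{0..l}. w + t *\<^sub>R e \<in> G}"
  shows "ennreal (1 / 2) * emeasure lborel D \<le> emeasure lborel G"
proof -
  have "ennreal (l / 2) * emeasure lborel D = (\<integral>\<^sup>+z. ennreal (l / 2) * indicator D z \<partial>lborel)"
    by (rule nn_integral_cmult_indicator[symmetric]) simp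
  also have "\<dots> \<le> (\<integral>\<^sup>+z. \<integral>\<^sup>+t. indicator G (z + t *\<^sub>R e) * indicator {0..l} t \<partial>lborel \<partial>lborel)"
  proof (rule nn_integral_mono)
    fix z :: 'a
    have "(\<integral>\<^sup>+t. indicator G (z + t *\<^sub>R e) * indicator {0..l} t \<partial>lborel)
       = (\<integral>\<^sup>+t. indicator {t\<in>{0..l}. z + t *\<^sub>R e \<in> G} t \<partial>lborel)"
      by (intro nn_integral_cong) (auto simp: indicator_def)
    also have "\<dots> = emeasure lborel {t\<in>{0..l}. z + t *\<^sub>R e \<in> G}"
      by (rule nn_integral_indicator) measurable
    finally show "ennreal (l / 2) * indicator D z \<le> (\<integral>\<^sup>+t. indicator G (z + t *\<^sub>R e) * indicator {0..l} t \<partial>lborel)"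
      using seg[of z] by (cases "z \<in> D") simp_all
  qed
  also have "\<dots> = (\<integral>\<^sup>+t. \<integral>\<^sup>+z. indicator G (z + t *\<^sub>R e) * indicator {0..l} t \<partial>lborel \<partial>lborel)"
    by (rule lborel_pair.Fubini') simp
  also have "\<dots> = (\<integral>\<^sup>+t. emeasure lborel G * indicator {0..l} t \<partial>lborel)"
    using nn_integral_lborel_translate[of "indicator G"] by (simp add: nn_integral_multc)
  also have "\<dots> = emeasure lborel G * ennreal l"
    using l by (subst nn_integral_cmult_indicator) simp_all
  finally have main: "ennreal (l / 2) * emeasure lborel D \<le> emeasure lborel G * ennreal l" .
  have 1: "ennreal (1 / l) * ennreal (l / 2) = ennreal (1 / 2)"
    by (subst ennreal_mult[symmetric]) (use l in simp_all)
  have 2: "ennreal (1 / l) * ennreal l = 1"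
    by (subst ennreal_mult[symmetric]) (use l in simp_all)
  have "ennreal (1 / 2) * emeasure lborel D = ennreal (1 / l) * (ennreal (l / 2) * emeasure lborel D)"
    by (simp only: mult.assoc[symmetric] 1)
  also have "\<dots> \<le> ennreal (1 / l) * (emeasure lborel G * ennreal l)"
    by (rule mult_left_mono[OF main]) simp
  also have "\<dots> = (ennreal (1 / l) * ennreal l) * emeasure lborel G" by (simp only: mult_ac)
  finally show ?thesis by (simp only: 2 mult_1)
qed

section \<open>The pointwise slope\<close>

text \<open>
For Lipschitz f the limsup is finite, so that its conversion to a real number is faithful and all later arguments can
be phrased with real inequalities.
\<close>

lemma ereal_Lip:
  assumes L: "L-lipschitz_on UNIV f"
  shows "ereal (Lip f x) = Limsup (at_right 0) (lip_quot f x)" and "0 \<le> Lip f x"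
proof -
  have L0: "L \<ge> 0" using L by (rule lipschitz_on_nonneg)
  have up: "lip_quot f x r \<le> ereal L" if "r > 0" for r
    unfolding lip_quot_def
  proof (rule SUP_least)
    fix y assume y: "y \<in> ball x r"
    have "\<bar>f x - f y\<bar> \<le> L * dist x y" using lipschitz_onD[OF L, of x y] by (simp add: dist_real_def)
    also have "\<dots> \<le> L * r" using y L0 by (intro mult_left_mono) auto
    finally show "ereal (\<bar>f x - f y\<bar> / r) \<le> ereal L" using that by (simp add: field_simps)
  qed
  have lo: "0 \<le> lip_quot f x r" if "r > 0" for r
    unfolding lip_quot_def using that
    by (intro SUP_upper2[of x]) auto
  have ev: "\<forall>\<^sub>F r in at_right 0. r > (0::real)" by (rule eventually_at_right_less)
  have 1: "Limsup (at_right 0) (lip_quot f x) \<le> ereal L"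
    by (rule Limsup_bounded, rule eventually_mono[OF ev up])
  have 2: "0 \<le> Limsup (at_right 0) (lip_quot f x)"
    by (rule le_Limsup[OF trivial_limit_at_right_real], rule eventually_mono[OF ev lo])
  obtain c where c: "Limsup (at_right 0) (lip_quot f x) = ereal c" "0 \<le> c"
    using 1 2 by (cases "Limsup (at_right 0) (lip_quot f x)") auto
  then have "Lip f x = c" by (simp add: Lip_def)
  with c show "ereal (Lip f x) = Limsup (at_right 0) (lip_quot f x)" "0 \<le> Lip f x" by simp_all
qed

lemma increment_le_of_Lip_less:
  assumes L: "L-lipschitz_on UNIV f" and c: "Lip f x < c"
  shows "\<exists>d>0. \<forall>y. dist x y < d \<longrightarrow> \<bar>f x - f y\<bar> \<le> c * dist x y"
proof -
  have "\<forall>\<^sub>F r in at_right 0. lip_quot f x r < ereal c"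
    by (rule Limsup_lessD) (use c ereal_Lip(1)[OF L, of x] in \<open>metis less_ereal.simps(1)\<close>)
  then obtain d where d: "d > 0" "\<And>r. 0 < r \<Longrightarrow> r < d \<Longrightarrow> lip_quot f x r < ereal c"
    unfolding eventually_at_right_field by auto
  have c0: "c > 0" using c ereal_Lip(2)[OF L, of x] by simp
  have scale: "\<bar>f x - f y\<bar> \<le> c * r" if "dist x y < r" "r < d" for y r
  proof -
    have r: "r > 0" using that(1) zero_le_dist[of x y] by linarith
    have "ereal (\<bar>f x - f y\<bar> / r) \<le> lip_quot f x r"
      unfolding lip_quot_def using that by (intro SUP_upper) simp
    also have "\<dots> < ereal c" using d(2) r that by simp
    finally show ?thesis using r by (simp add: field_simps)
  qed
  have "\<bar>f x - f y\<bar> \<le> c * dist x y" if y: "dist x y < d" for y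
  proof (rule field_le_epsilon)
    fix e :: real assume e: "0 < e"
    define r where "r = min ((dist x y + d) / 2) (dist x y + e / c)"
    have "r \<le> (dist x y + d) / 2" unfolding r_def by (rule min.cobounded1)
    also have "\<dots> < d" using y by (simp add: field_simps)
    finally have "r < d" .
    moreover have "dist x y < r" using y e c0 by (auto simp: r_def)
    ultimately have "dist x y < r" "r < d" by auto
    then have "\<bar>f x - f y\<bar> \<le> c * r" by (rule scale)
    also have "\<dots> \<le> c * (dist x y + e / c)" using c0 by (intro mult_left_mono) (auto simp: r_def)
    also have "\<dots> = c * dist x y + e" using c0 by (simp add: field_simps)
    finally show "\<bar>f x - f y\<bar> \<le> c * dist x y + e" .
  qed
  then show ?thesis using d by blast
qed

lemma increment_gt_of_Lip_gt:
  assumes L: "L-lipschitz_on UNIV f" and c: "c < Lip f x" and d: "d > 0"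
  obtains r y where "0 < r" "r < d" "dist x y < r" "c * r < \<bar>f x - f y\<bar>"
proof -
  have "\<exists>r y. 0 < r \<and> r < d \<and> dist x y < r \<and> c * r < \<bar>f x - f y\<bar>"
  proof (rule ccontr)
    assume no: "\<not> ?thesis"
    have "lip_quot f x r \<le> ereal c" if "0 < r" "r < d" for r
      unfolding lip_quot_def
    proof (rule SUP_least)
      fix y assume "y \<in> ball x r"
      then have "\<bar>f x - f y\<bar> \<le> c * r" using no that by (force simp: not_less)
      then show "ereal (\<bar>f x - f y\<bar> / r) \<le> ereal c" using that by (simp add: field_simps)
    qed
    then have "\<forall>\<^sub>F r in at_right 0. lip_quot f x r \<le> ereal c"
      unfolding eventually_at_right_field using d by auto
    then have "Limsup (at_right 0) (lip_quot f x) \<le> ereal c" by (rule Limsup_bounded)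
    then show False using c ereal_Lip(1)[OF L, of x] by (metis ereal_less_eq(3) not_le)
  qed
  then show ?thesis using that by blast
qed

lemma Lip_le_of_increment_le:
  assumes L: "L-lipschitz_on UNIV f" and d: "d > 0"
    and c: "c \<ge> 0" and le: "\<And>y. dist x y < d \<Longrightarrow> \<bar>f x - f y\<bar> \<le> c * dist x y"
  shows "Lip f x \<le> c"
proof (rule ccontr)
  assume "\<not> Lip f x \<le> c"
  then obtain r y where ry: "0 < r" "r < d" "dist x y < r" "c * r < \<bar>f x - f y\<bar>"
    using increment_gt_of_Lip_gt[OF L _ d] by (metis not_le)
  have "c * dist x y \<le> c * r" using ry c by (intro mult_left_mono) auto
  then show False using le[of y] ry by linarith
qed

text \<open>
Continuity of Lip f makes its integral along a segment differentiable with derivative Lip f, so the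
mean value inequality applies; in other words, Lip f is an upper gradient of f.
\<close>

lemma increment_le_integral_Lip:
  fixes f :: "real ^ 'n \<Rightarrow> real"
  assumes L: "L-lipschitz_on UNIV f" and cont: "continuous_on UNIV (Lip f)"
  shows "\<bar>f (x + h) - f x\<bar> \<le> norm h * integral {0..1} (\<lambda>t. Lip f (x + t *\<^sub>R h))"
proof (cases "h = 0")
  case False
  define u where "u t = Lip f (x + t *\<^sub>R h)" for t
  define V where "V t = norm h * integral {0..t} u" for t
  have u: "continuous_on {0..1} u" unfolding u_def
    by (intro continuous_on_compose2[OF cont] continuous_intros) auto
  have "\<bar>f (x + 1 *\<^sub>R h) - f (x + 0 *\<^sub>R h)\<bar> \<le> V 1 - V 0"
  proof (rule increment_le_of_local_bound[where v = "\<lambda>t. norm h * u t"])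
    fix t :: real assume t: "0 \<le> t" "t \<le> 1"
    show "(V has_real_derivative norm h * u t) (at t within {0..1})"
      unfolding V_def using t by (intro DERIV_cmult integral_has_real_derivative u) auto
    fix \<epsilon> :: real assume e: "\<epsilon> > 0"
    have h: "norm h > 0" using False by simp
    have "Lip f (x + t *\<^sub>R h) < u t + \<epsilon> / norm h" using e h by (simp add: u_def)
    then obtain d where d: "d > 0" "\<And>y. dist (x + t *\<^sub>R h) y < d \<Longrightarrow>
        \<bar>f (x + t *\<^sub>R h) - f y\<bar> \<le> (u t + \<epsilon> / norm h) * dist (x + t *\<^sub>R h) y"
      using increment_le_of_Lip_less[OF L] by blast
    show "\<exists>d>0. \<forall>s\<in>{0..1}. \<bar>s - t\<bar> < d \<longrightarrow>
        \<bar>f (x + s *\<^sub>R h) - f (x + t *\<^sub>R h)\<bar> \<le> (norm h * u t + \<epsilon>) * \<bar>s - t\<bar>"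
    proof (intro exI[of _ "d / norm h"] conjI ballI impI)
      fix s :: real assume s: "\<bar>s - t\<bar> < d / norm h"
      have ds: "dist (x + t *\<^sub>R h) (x + s *\<^sub>R h) = \<bar>s - t\<bar> * norm h"
        by (simp add: dist_norm flip: scaleR_diff_left) (simp add: abs_minus_commute)
      also have "\<dots> < d" using s h by (simp add: field_simps)
      finally have "\<bar>f (x + t *\<^sub>R h) - f (x + s *\<^sub>R h)\<bar> \<le> (u t + \<epsilon> / norm h) * (\<bar>s - t\<bar> * norm h)"
        using d(2)[of "x + s *\<^sub>R h"] by (simp only: ds)
      also have "\<dots> = (norm h * u t + \<epsilon>) * \<bar>s - t\<bar>" using h by (simp add: field_simps)
      finally show "\<bar>f (x + s *\<^sub>R h) - f (x + t *\<^sub>R h)\<bar> \<le> (norm h * u t + \<epsilon>) * \<bar>s - t\<bar>"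
        by (simp add: abs_minus_commute)
    qed (use d h in simp)
  qed simp
  then show ?thesis by (simp add: V_def u_def[abs_def])
qed simp

lemma increment_le_of_Lip_le_on_ball:
  fixes f :: "real ^ 'n \<Rightarrow> real"
  assumes L: "L-lipschitz_on UNIV f" and cont: "continuous_on UNIV (Lip f)"
    and K: "\<And>z. z \<in> ball x \<rho> \<Longrightarrow> Lip f z \<le> K" and y: "y \<in> ball x \<rho>" "z \<in> ball x \<rho>"
  shows "\<bar>f y - f z\<bar> \<le> K * norm (y - z)"
proof -
  have inc: "\<bar>f (z + (y - z)) - f z\<bar> \<le> norm (y - z) * integral {0..1} (\<lambda>t. Lip f (z + t *\<^sub>R (y - z)))"
    by (rule increment_le_integral_Lip[OF L cont])
  have "integral {0..1} (\<lambda>t. Lip f (z + t *\<^sub>R (y - z))) \<le> integral {0..1} (\<lambda>t::real. K)"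
  proof (rule integral_le)
    show "(\<lambda>t. Lip f (z + t *\<^sub>R (y - z))) integrable_on {0..1::real}"
      by (intro integrable_continuous_real continuous_on_compose2[OF cont] continuous_intros) auto
    fix t :: real assume t: "t \<in> {0..1}"
    have "(1 - t) *\<^sub>R z + t *\<^sub>R y \<in> ball x \<rho>"
      using t by (intro convexD[OF convex_ball y(2,1)]) auto
    then show "Lip f (z + t *\<^sub>R (y - z)) \<le> K"
      by (intro K) (simp add: algebra_simps)
  qed (rule integrable_const_ivl)
  then have "norm (y - z) * integral {0..1} (\<lambda>t. Lip f (z + t *\<^sub>R (y - z))) \<le> norm (y - z) * K"
    by (intro mult_left_mono) simp_all
  with inc show ?thesis by (simp add: mult.commute)
qed

lemma GDERIV_grad:
  fixes f :: "real ^ 'n \<Rightarrow> real"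
  assumes diff: "f differentiable (at x)"
  shows "GDERIV f x :> grad f x"
proof -
  obtain f' where f': "(f has_derivative f') (at x)" using diff by (auto simp: differentiable_def)
  define D where "D = (\<Sum>b\<in>Basis. f' b *\<^sub>R b)"
  have "f' h = h \<bullet> D" for h
  proof -
    interpret linear f' using f' has_derivative_linear by blast
    have "f' h = f' (\<Sum>b\<in>Basis. (h \<bullet> b) *\<^sub>R b)" by (simp add: euclidean_representation)
    also have "\<dots> = (\<Sum>b\<in>Basis. (h \<bullet> b) * f' b)" by (simp add: sum scale)
    also have "\<dots> = h \<bullet> D" by (simp add: D_def inner_sum_right mult.commute)
    finally show ?thesis .
  qed
  then have "(f has_derivative (\<lambda>h. h \<bullet> D)) (at x)" using f' by (metis ext)
  then have "GDERIV f x :> D" by (simp add: gderiv_def)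
  with grad_eqI[OF this] show ?thesis by simp
qed

lemma Lip_le_norm_grad:
  fixes f :: "real ^ 'n \<Rightarrow> real"
  assumes L: "L-lipschitz_on UNIV f" and diff: "f differentiable (at x)"
  shows "Lip f x \<le> norm (grad f x)"
proof (rule field_le_epsilon)
  define D where "D = grad f x"
  have fD: "(f has_derivative (\<lambda>h. h \<bullet> D)) (at x)"
    using GDERIV_grad[OF diff] by (simp add: gderiv_def D_def)
  fix e :: real assume e: "e > 0"
  then obtain d where d: "d > 0" "\<And>y. norm (y - x) < d \<Longrightarrow> \<bar>f y - f x - (y - x) \<bullet> D\<bar> \<le> e * norm (y - x)"
    using fD unfolding has_derivative_at_alt by (metis real_norm_def)
  have "Lip f x \<le> norm D + e"
  proof (rule Lip_le_of_increment_le[OF L d(1)])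
    fix y assume y: "dist x y < d"
    have "\<bar>(y - x) \<bullet> D\<bar> \<le> norm (y - x) * norm D" by (rule Cauchy_Schwarz_ineq2)
    with d(2)[of y] y show "\<bar>f x - f y\<bar> \<le> (norm D + e) * dist x y"
      by (simp add: dist_norm norm_minus_commute algebra_simps)
  qed (use e in simp)
  then show "Lip f x \<le> norm (grad f x) + e" by (simp add: D_def)
qed

section \<open>Differentiability almost everywhere\<close>

text \<open>
The proportion \<kappa> depends on \<epsilon>, on the bound B of the slope and on the dimension, but not on the point x: the
covering lemma needs a uniform proportion. The tolerance \<gamma> for the Lipschitz constant near x may depend on x,
because it only decides how small a ball has to be taken.
\<close>

lemma affine_approximation_portion:
  fixes f :: "real ^ 'n \<Rightarrow> real"
  assumes L: "L-lipschitz_on UNIV f" and cont: "continuous_on UNIV (Lip f)"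
    and B: "\<And>z. Lip f z \<le> B" and \<epsilon>: "\<epsilon> > 0"
  shows "\<exists>\<kappa>>0. \<forall>x d. 0 < Lip f x \<longrightarrow> 0 < d \<longrightarrow> (\<exists>r G. 0 < r \<and> r < d \<and> G \<subseteq> ball x r \<and> G \<in> lmeasurable \<and>
      \<kappa> * measure lebesgue (ball x r) \<le> measure lebesgue G \<and>
      (\<forall>z\<in>G. \<exists>a \<delta>. \<delta> > 0 \<and> (\<forall>h. norm h \<le> \<delta> \<longrightarrow> \<bar>f (z + h) - f z - a \<bullet> h\<bar> \<le> \<epsilon> * norm h)))"
proof -
  have B0: "B \<ge> 0" using B[of 0] ereal_Lip(2)[OF L, of 0] by simp
  define M where "M = max 2 (2 * (B + 1) / \<epsilon>)"
  define \<theta> where "\<theta> = \<epsilon> / (2 * M)"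
  \<comment> \<open>Translating a segment of length l > r/2 by at most \<eta> r changes its rise by at most 4 (B + 1) \<eta> l, which
    may use up half of the admissible defect \<theta>/8; the other half pays for 2 \<gamma>.\<close>
  define \<eta> where "\<eta> = min 1 (\<theta> / (64 * (B + 1)))"
  have M: "M \<ge> 2" "2 * (B + 1) / \<epsilon> \<le> M" by (auto simp: M_def)
  have \<theta>: "\<theta> > 0" using \<epsilon> M by (simp add: \<theta>_def)
  have \<eta>: "\<eta> > 0" "\<eta> \<le> 1" "\<eta> \<le> \<theta> / (64 * (B + 1))" using \<theta> B0 by (auto simp: \<eta>_def)
  have \<eta>B: "4 * (B + 1) * \<eta> \<le> \<theta> / 16"
    using \<eta>(3) B0 by (simp add: field_simps)
  define \<kappa> where "\<kappa> = 1 / 2 * (\<eta> / 3) ^ CARD('n)"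
  have "\<exists>r G. 0 < r \<and> r < d \<and> G \<subseteq> ball x r \<and> G \<in> lmeasurable \<and>
      \<kappa> * measure lebesgue (ball x r) \<le> measure lebesgue G \<and>
      (\<forall>z\<in>G. \<exists>a \<delta>. \<delta> > 0 \<and> (\<forall>h. norm h \<le> \<delta> \<longrightarrow> \<bar>f (z + h) - f z - a \<bullet> h\<bar> \<le> \<epsilon> * norm h))"
    if x: "0 < Lip f x" and d: "0 < d" for x d
  proof -
    define c where "c = Lip f x"
    define \<gamma> where "\<gamma> = min 1 (min (c / 4) (\<theta> / 32))"
    define K where "K = c + \<gamma>"
    have c: "c > 0" "c \<le> B" using x B by (auto simp: c_def)
    have \<gamma>: "\<gamma> > 0" "\<gamma> \<le> 1" "\<gamma> \<le> c / 4" "\<gamma> \<le> \<theta> / 32" using c \<theta> by (auto simp: \<gamma>_def)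
    have K: "K > 0" "K \<le> B + 1" using c \<gamma> by (auto simp: K_def)
    have "isCont (Lip f) x" using cont by (simp add: continuous_on_eq_continuous_at)
    then obtain \<rho> where \<rho>: "\<rho> > 0" "\<And>z. dist z x < \<rho> \<Longrightarrow> dist (Lip f z) (Lip f x) < \<gamma>"
      unfolding continuous_at_eps_delta using \<gamma>(1) by blast
    have LK: "Lip f z \<le> K" if "z \<in> ball x \<rho>" for z
      using \<rho>(2)[of z] that by (simp add: K_def c_def dist_commute dist_real_def)
    have lip: "\<bar>f y - f z\<bar> \<le> K * norm (y - z)" if "y \<in> ball x \<rho>" "z \<in> ball x \<rho>" for y z
      by (rule increment_le_of_Lip_le_on_ball[OF L cont LK that])
    obtain r y where ry: "0 < r" "r < min (d / 3) (\<rho> / 8)" "dist x y < r" "(c - \<gamma>) * r < \<bar>f x - f y\<bar>"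
      using increment_gt_of_Lip_gt[OF L, of "c - \<gamma>" x "min (d / 3) (\<rho> / 8)"] \<gamma> d \<rho> by (auto simp: c_def)
    \<comment> \<open>The end points are named such that f increases from P to Q.\<close>
    have "\<exists>P Q. dist x P \<le> r \<and> dist x Q \<le> r \<and> dist P Q < r \<and> (c - \<gamma>) * r < f Q - f P"
    proof (cases "f x \<le> f y")
      case True
      with ry show ?thesis by (intro exI[of _ x] exI[of _ y]) auto
    next
      case False
      with ry show ?thesis by (intro exI[of _ y] exI[of _ x]) (auto simp: dist_commute)
    qed
    then obtain P Q where PQ: "dist x P \<le> r" "dist x Q \<le> r" "dist P Q < r" "(c - \<gamma>) * r < f Q - f P"
      by blast
    define l where "l = norm (Q - P)"
    define e where "e = (Q - P) /\<^sub>R l"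
    have lr: "l < r" using PQ(3) by (simp add: l_def dist_norm norm_minus_commute)
    have "f Q - f P \<le> K * l" using lip[of Q P] PQ ry by (simp add: l_def)
    then have "(c - \<gamma>) * r < (c + \<gamma>) * l" using PQ(4) by (simp add: K_def)
    moreover have "(3 / 4 * c) * r \<le> (c - \<gamma>) * r" using \<gamma> ry by (intro mult_right_mono) auto
    moreover have "(c + \<gamma>) * l \<le> (5 / 4 * c) * l" using \<gamma> by (intro mult_right_mono) (auto simp: l_def)
    ultimately have "c * (3 / 4 * r) < c * (5 / 4 * l)" by linarith
    then have rl: "r < 2 * l" using c ry by simp
    have l: "l > 0" using rl ry by simp
    have e: "norm e = 1" using l by (simp add: e_def l_def)
    have Pl: "P + l *\<^sub>R e = Q" using l by (simp add: e_def)
    define G where "G = {z \<in> cball x (2 * r). \<forall>s\<in>{0..l/8}.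
        (K - \<theta>) * s \<le> f (z + s *\<^sub>R e) - f z \<and> (K - \<theta>) * s \<le> f z - f (z - s *\<^sub>R e)}"
    have fc: "continuous_on UNIV f" using L by (rule lipschitz_on_continuous_on)
    have G_eq: "G = cball x (2 * r) \<inter> (\<Inter>s\<in>{0..l/8}. {z. (K - \<theta>) * s \<le> f (z + s *\<^sub>R e) - f z} \<inter>
        {z. (K - \<theta>) * s \<le> f z - f (z - s *\<^sub>R e)})"
      by (auto simp: G_def)
    have "closed G" unfolding G_eq
      by (intro closed_Int closed_INT ballI closed_cball closed_Collect_le continuous_intros
          continuous_on_compose2[OF fc]) auto
    moreover have "bounded G" by (rule bounded_subset[OF bounded_cball]) (auto simp: G_def)
    ultimately have cG: "compact G" by (simp add: compact_eq_bounded_closed)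
    have near: "w + t *\<^sub>R e \<in> cball x (2 * r)" if "w \<in> ball P (\<eta> * r)" "t \<in> {0..l}" for w t
    proof -
      have "(1 - t / l) *\<^sub>R P + (t / l) *\<^sub>R Q \<in> cball x r"
        using that l PQ by (intro convexD[OF convex_cball]) auto
      also have "(1 - t / l) *\<^sub>R P + (t / l) *\<^sub>R Q = P + t *\<^sub>R e"
        by (simp add: e_def algebra_simps divide_inverse)
      finally have "dist x (P + t *\<^sub>R e) \<le> r" by simp
      moreover have "dist (P + t *\<^sub>R e) (w + t *\<^sub>R e) < \<eta> * r" using that by (simp add: dist_norm)
      moreover have "\<eta> * r \<le> 1 * r" using \<eta> ry by (intro mult_right_mono) auto
      ultimately have "dist x (w + t *\<^sub>R e) \<le> 2 * r"
        using dist_triangle[of x "w + t *\<^sub>R e" "P + t *\<^sub>R e"] by linarith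
      then show ?thesis by simp
    qed
    have near': "z \<in> ball x \<rho>" if "z \<in> cball x (2 * r)" for z
      using that ry by (auto simp: less_le_trans)
    have "ennreal (1 / 2) * emeasure lborel (ball P (\<eta> * r)) \<le> emeasure lborel G"
    proof (rule measure_ge_of_parallel_segments[OF _ _ l])
      show "G \<in> sets borel" using \<open>closed G\<close> by simp
      fix w assume w: "w \<in> ball P (\<eta> * r)"
      define g where "g t = f (w + t *\<^sub>R e)" for t
      have gl: "\<bar>g s - g t\<bar> \<le> K * \<bar>s - t\<bar>" if "s \<in> {0..l}" "t \<in> {0..l}" for s t
        using lip[OF near'[OF near[OF w that(1)]] near'[OF near[OF w that(2)]]] e
        by (simp add: g_def flip: scaleR_diff_left)
      have "(K - \<theta> / 8) * l \<le> g l - g 0"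
      proof -
        have in1: "w \<in> ball x \<rho>" "w + l *\<^sub>R e \<in> ball x \<rho>" "P \<in> ball x \<rho>" "Q \<in> ball x \<rho>"
          using near'[OF near[OF w, of 0]] near'[OF near[OF w, of l]] l near'[of P] near'[of Q] PQ ry by auto
        have "norm (w - P) \<le> \<eta> * r" using w by (simp add: dist_norm norm_minus_commute)
        then have wP: "K * norm (w - P) \<le> K * (\<eta> * r)" using K by (intro mult_left_mono) auto
        have "\<bar>f w - f P\<bar> \<le> K * norm (w - P)" by (rule lip[OF in1(1,3)])
        then have 1: "f w - f P \<le> K * (\<eta> * r)" using wP by linarith
        have "w + l *\<^sub>R e - Q = w - P" by (simp flip: Pl)
        then have "\<bar>f (w + l *\<^sub>R e) - f Q\<bar> \<le> K * norm (w - P)" using lip[OF in1(2,4)] by (simp only:)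
        then have 2: "f Q - f (w + l *\<^sub>R e) \<le> K * (\<eta> * r)" using wP by linarith
        have "K * (\<eta> * r) \<le> K * (\<eta> * (2 * l))" using K \<eta> rl by (intro mult_left_mono) auto
        also have "\<dots> \<le> (B + 1) * (\<eta> * (2 * l))" using K \<eta> l by (intro mult_right_mono) auto
        finally have "2 * (K * (\<eta> * r)) \<le> (4 * (B + 1) * \<eta>) * l" by (simp add: algebra_simps)
        also have "\<dots> \<le> \<theta> / 16 * l" using \<eta>B l by (intro mult_right_mono) auto
        finally have 3: "2 * (K * (\<eta> * r)) \<le> \<theta> / 16 * l" .
        have "(K - \<theta> / 16) * l \<le> (c - \<gamma>) * l" using \<gamma> l by (intro mult_right_mono) (auto simp: K_def)
        also have "\<dots> \<le> (c - \<gamma>) * r" using \<gamma> c lr by (intro mult_left_mono) auto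
        finally have 4: "(K - \<theta> / 16) * l \<le> f Q - f P" using PQ(4) by simp
        show ?thesis using 1 2 3 4 by (simp add: g_def algebra_simps)
      qed
      then obtain T where T: "closed T" "T \<subseteq> {l/8..7*l/8}" "ennreal (l / 2) \<le> emeasure lborel T"
        "\<And>t s. t \<in> T \<Longrightarrow> 0 \<le> s \<Longrightarrow> s \<le> l / 8 \<Longrightarrow>
          (K - \<theta>) * s \<le> g (t + s) - g t \<and> (K - \<theta>) * s \<le> g t - g (t - s)"
        using nearly_extremal_portion[OF l \<theta> gl] by blast
      have "T \<subseteq> {t\<in>{0..l}. w + t *\<^sub>R e \<in> G}"
      proof
        fix t assume t: "t \<in> T"
        then have tl: "t \<in> {0..l}" using T(2) l by force
        have "w + t *\<^sub>R e \<in> G" unfolding G_def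
          using T(4)[OF t] near[OF w tl] by (auto simp: g_def algebra_simps)
        with tl show "t \<in> {t\<in>{0..l}. w + t *\<^sub>R e \<in> G}" by simp
      qed
      moreover have "{t\<in>{0..l}. w + t *\<^sub>R e \<in> G} \<in> sets lborel"
      proof -
        have [measurable]: "G \<in> sets borel" using \<open>closed G\<close> by simp
        show ?thesis by measurable
      qed
      ultimately have "emeasure lborel T \<le> emeasure lborel {t\<in>{0..l}. w + t *\<^sub>R e \<in> G}"
        by (rule emeasure_mono)
      with T(3) show "ennreal (l / 2) \<le> emeasure lborel {t\<in>{0..l}. w + t *\<^sub>R e \<in> G}"
        by (rule order_trans)
    qed simp
    then have "ennreal (1 / 2 * measure lebesgue (ball P (\<eta> * r))) \<le> ennreal (measure lebesgue G)"
    proof -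
      have "emeasure lborel G = ennreal (measure lebesgue G)"
        using emeasure_eq_measure2[OF lmeasurable_compact[OF cG]] \<open>closed G\<close> by simp
      moreover have "emeasure lborel (ball P (\<eta> * r)) = ennreal (measure lebesgue (ball P (\<eta> * r)))"
        using emeasure_eq_measure2[OF lmeasurable_ball] by simp
      moreover have "ennreal (1 / 2 * measure lebesgue (ball P (\<eta> * r)))
          = ennreal (1 / 2) * ennreal (measure lebesgue (ball P (\<eta> * r)))"
        by (rule ennreal_mult) simp_all
      ultimately show ?thesis using \<open>ennreal (1 / 2) * _ \<le> _\<close> by (simp only:)
    qed
    then have mG: "1 / 2 * measure lebesgue (ball P (\<eta> * r)) \<le> measure lebesgue G"
      by (simp add: ennreal_le_iff)
    have "1 / 2 * measure lebesgue (ball P (\<eta> * r)) = \<kappa> * measure lebesgue (ball x (3 * r))"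
      using \<eta> ry by (simp add: \<kappa>_def content_ball_conv_unit_ball[of "\<eta> * r" P] content_ball_conv_unit_ball[of "3 * r" x]
         power_mult_distrib power_divide)
    with mG have mG': "\<kappa> * measure lebesgue (ball x (3 * r)) \<le> measure lebesgue G" by simp
    have "\<exists>a \<delta>. \<delta> > 0 \<and> (\<forall>h. norm h \<le> \<delta> \<longrightarrow> \<bar>f (z + h) - f z - a \<bullet> h\<bar> \<le> \<epsilon> * norm h)" if z: "z \<in> G" for z
    proof (intro exI[of _ "K *\<^sub>R e"] exI[of _ "l / 8 / M"] conjI allI impI)
      show "0 < l / 8 / M" using l M by simp
      fix h :: "real ^ 'n" assume h: "norm h \<le> l / 8 / M"
      have inb: "y \<in> ball x \<rho>" if "dist z y \<le> l / 8" for y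
      proof -
        have "dist x z \<le> 2 * r" using z by (simp add: G_def)
        then show ?thesis using dist_triangle[of x y z] that lr ry by simp
      qed
      have "\<bar>f (z + h) - f z - (K *\<^sub>R e) \<bullet> h\<bar> \<le> (\<theta> * M + K / M) * norm h"
      proof (rule affine_of_extremal_direction[OF e _ _ M(1), where \<sigma> = "l / 8"])
        show "M * norm h \<le> l / 8" using h M by (simp add: field_simps)
      qed (use K \<theta> l z lip inb in \<open>auto simp: G_def\<close>)
      also have "\<dots> \<le> \<epsilon> * norm h"
      proof (rule mult_right_mono)
        have "\<theta> * M = \<epsilon> / 2" using M by (simp add: \<theta>_def)
        moreover have "K / M \<le> \<epsilon> / 2" using M K \<epsilon> by (simp add: field_simps)
        ultimately have "\<theta> * M + K / M \<le> \<epsilon> / 2 + \<epsilon> / 2" by (intro add_mono) auto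
        then show "\<theta> * M + K / M \<le> \<epsilon>" by (simp only: field_sum_of_halves)
      qed simp
      finally show "\<bar>f (z + h) - f z - (K *\<^sub>R e) \<bullet> h\<bar> \<le> \<epsilon> * norm h" .
    qed
    moreover have "G \<subseteq> ball x (3 * r)" using ry by (auto simp: G_def)
    ultimately show ?thesis
      using ry mG' lmeasurable_compact[OF cG] by (intro exI[of _ "3 * r"] exI[of _ G]) auto
  qed
  moreover have "\<kappa> > 0" using \<eta> by (simp add: \<kappa>_def)
  ultimately show ?thesis by blast
qed

lemma bounded_above_of_compact_support:
  fixes g :: "real ^ 'n \<Rightarrow> real"
  assumes cont: "continuous_on UNIV g" and supp: "has_compact_support g"
  shows "\<exists>B. \<forall>z. g z \<le> B"
proof -
  define S where "S = {x. g x \<noteq> 0}"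
  have "bounded (g ` closure S)"
    using supp unfolding has_compact_support_def S_def
    by (intro compact_imp_bounded compact_continuous_image continuous_on_subset[OF cont]) auto
  then obtain b where b: "\<And>z. z \<in> closure S \<Longrightarrow> \<bar>g z\<bar> \<le> b" unfolding bounded_iff by auto
  have "g z \<le> max 0 b" for z
    using b[of z] closure_subset[of S] by (cases "z \<in> S") (auto simp: S_def)
  then show ?thesis by blast
qed

lemma AE_differentiable:
  fixes f :: "real ^ 'n \<Rightarrow> real"
  assumes L: "L-lipschitz_on UNIV f" and cont: "continuous_on UNIV (Lip f)"
    and supp: "has_compact_support (Lip f)"
  shows "AE x in lborel. f differentiable (at x)"
proof -
  define S where "S = {x. Lip f x \<noteq> 0}"
  have cS: "compact (closure S)" using supp by (simp add: has_compact_support_def S_def)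
  have bS: "bounded S" using cS by (meson bounded_subset closure_subset compact_imp_bounded)
  obtain B where B: "\<And>z. Lip f z \<le> B"
    using bounded_above_of_compact_support[OF cont supp] by blast
  define flat where "flat \<epsilon> x \<longleftrightarrow> (\<exists>a \<delta>. \<delta> > 0 \<and> (\<forall>h. norm h \<le> \<delta> \<longrightarrow> \<bar>f (x + h) - f x - a \<bullet> h\<bar> \<le> \<epsilon> * norm h))"
    for \<epsilon> x
  have neg: "negligible {x\<in>S. \<not> flat \<epsilon> x}" if \<epsilon>: "\<epsilon> > 0" for \<epsilon>
  proof -
    obtain \<kappa> where \<kappa>: "\<kappa> > 0" "\<And>x d. 0 < Lip f x \<Longrightarrow> 0 < d \<Longrightarrow> (\<exists>r G. 0 < r \<and> r < d \<and> G \<subseteq> ball x r \<and> G \<in> lmeasurable \<and>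
      \<kappa> * measure lebesgue (ball x r) \<le> measure lebesgue G \<and> (\<forall>z\<in>G. flat \<epsilon> z))"
      using affine_approximation_portion[OF L cont B \<epsilon>] unfolding flat_def by blast
    show ?thesis
    proof (rule negligible_of_porous[OF _ \<kappa>(1)])
      show "bounded {x\<in>S. \<not> flat \<epsilon> x}" by (rule bounded_subset[OF bS]) auto
      fix x and d :: real assume x: "x \<in> {x\<in>S. \<not> flat \<epsilon> x}" and d: "d > 0"
      have "0 < Lip f x" using x ereal_Lip(2)[OF L, of x] by (auto simp: S_def less_le)
      from \<kappa>(2)[OF this d] show "\<exists>r G. 0 < r \<and> r < d \<and> G \<subseteq> ball x r \<and> G \<inter> {x\<in>S. \<not> flat \<epsilon> x} = {} \<and>
        G \<in> lmeasurable \<and> \<kappa> * measure lebesgue (ball x r) \<le> measure lebesgue G" by blast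
    qed
  qed
  have flat0: "flat \<epsilon> x" if x: "x \<notin> S" "\<epsilon> > 0" for x \<epsilon>
  proof -
    obtain d where d: "d > 0" "\<And>y. dist x y < d \<Longrightarrow> \<bar>f x - f y\<bar> \<le> \<epsilon> * dist x y"
      using increment_le_of_Lip_less[OF L, of x \<epsilon>] x unfolding S_def by auto
    show ?thesis unfolding flat_def
    proof (intro exI[of _ "0 :: real ^ 'n"] exI[of _ "d / 2"] conjI allI impI)
      fix h :: "real ^ 'n" assume "norm h \<le> d / 2"
      then show "\<bar>f (x + h) - f x - 0 \<bullet> h\<bar> \<le> \<epsilon> * norm h"
        using d(2)[of "x + h"] d(1) by (simp add: dist_norm abs_minus_commute)
    qed (use d in simp)
  qed
  define N where "N = (\<Union>k. {x\<in>S. \<not> flat (1 / Suc k) x})"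
  have "negligible N" unfolding N_def by (intro negligible_countable_Union) (auto intro: neg)
  then have "AE x in lebesgue. x \<notin> N" using AE_not_in negligible_iff_null_sets by blast
  then have "AE x in lborel. x \<notin> N" by (simp add: AE_completion_iff)
  then show ?thesis
  proof eventually_elim
    case (elim x)
    show ?case
    proof (rule differentiable_of_affine_approximations)
      fix \<epsilon> :: real assume \<epsilon>: "\<epsilon> > 0"
      then obtain k where k: "inverse (real (Suc k)) < \<epsilon>" using reals_Archimedean by blast
      have "flat (1 / Suc k) x" using elim flat0[of x "1 / Suc k"] by (cases "x \<in> S") (auto simp: N_def)
      then obtain a \<delta> where a: "\<delta> > 0" "\<And>h. norm h \<le> \<delta> \<Longrightarrow> \<bar>f (x + h) - f x - a \<bullet> h\<bar> \<le> 1 / Suc k * norm h"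
        unfolding flat_def by blast
      have "1 / Suc k * norm h \<le> \<epsilon> * norm h" for h :: "real ^ 'n"
        using k by (intro mult_right_mono) (auto simp: inverse_eq_divide)
      with a show "\<exists>a \<delta>. \<delta> > 0 \<and> (\<forall>h. norm h \<le> \<delta> \<longrightarrow> \<bar>f (x + h) - f x - a \<bullet> h\<bar> \<le> \<epsilon> * norm h)"
        by (meson order_trans)
    qed
  qed
qed

section \<open>Superlevel sets of averages over segments\<close>

text \<open>
A pair (\<tau>, \<sigma>) counts if the interval [\<tau>, \<tau> + \<sigma>] carries mass more than \<sigma>^(m+2). Vitali's lemma selects disjoint
intervals whose fivefold enlargements swallow all of these intervals. The pairs swallowed by the enlargement of an
interval of length s have weighted measure at most (5 s)^(m+2), which is at most 5^(m+2) times the mass of that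
interval; the masses of disjoint intervals add up to at most the total mass.
\<close>

lemma interval_selection_bound:
  fixes v :: "real \<Rightarrow> ennreal"
  assumes v[measurable]: "v \<in> borel_measurable borel"
  shows "(\<integral>\<^sup>+\<tau>. \<integral>\<^sup>+\<sigma>. ennreal (\<sigma> ^ m) * indicator {0<..R} \<sigma> *
            (if ennreal (\<sigma> ^ (m + 2)) < (\<integral>\<^sup>+s\<in>{\<tau>..\<tau> + \<sigma>}. v s \<partial>lborel) then 1 else 0) \<partial>lborel \<partial>lborel)
         \<le> ennreal (5 ^ (m + 2)) * (\<integral>\<^sup>+s. v s \<partial>lborel)"
proof -
  define S where "S = {i::real \<times> real. snd i \<in> {0<..R} \<and>
      ennreal (snd i ^ (m + 2)) < (\<integral>\<^sup>+s\<in>{fst i..fst i + snd i}. v s \<partial>lborel)}"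
  define a where "a i = fst i + snd i / 2" for i :: "real \<times> real"
  define r where "r i = snd i / 2" for i :: "real \<times> real"
  define J where "J i = {fst i..fst i + snd i}" for i :: "real \<times> real"
  have J: "cball (a i) (r i) = J i" for i
    by (simp add: cball_eq_atLeastAtMost a_def r_def J_def)
  have "0 < r i \<and> r i \<le> R / 2" if "i \<in> S" for i
    using that by (auto simp: S_def r_def)
  then obtain C where C: "countable C" "C \<subseteq> S"
     "pairwise (\<lambda>i j. disjnt (cball (a i) (r i)) (cball (a j) (r j))) C"
    and cov: "\<And>i. i \<in> S \<Longrightarrow> \<exists>j. j \<in> C \<and>
                        \<not> disjnt (cball (a i) (r i)) (cball (a j) (r j)) \<and>
                        cball (a i) (r i) \<subseteq> ball (a j) (5 * r j)"
    by (rule Vitali_covering_lemma_cballs_balls[where a = a]) (assumption | blast)+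
  \<comment> \<open>A pair in S is dominated by the term of a selected interval j whose enlargement swallows it.\<close>
  define f where "f j \<tau> \<sigma> = ennreal ((5 * snd j) ^ m) * indicator (ball (a j) (5 * r j)) \<tau> *
      indicator {0..5 * snd j} \<sigma>" for j :: "real \<times> real" and \<tau> \<sigma> :: real
  have [measurable]: "ball (a j) (5 * r j) \<in> sets borel" for j by simp
  have pos: "snd j > 0" if "j \<in> C" for j using that C(2) by (auto simp: S_def)
  have pt: "ennreal (\<sigma> ^ m) * indicator {0<..R} \<sigma> *
            (if ennreal (\<sigma> ^ (m + 2)) < (\<integral>\<^sup>+s\<in>{\<tau>..\<tau> + \<sigma>}. v s \<partial>lborel) then 1 else 0)
        \<le> (\<integral>\<^sup>+j. f j \<tau> \<sigma> \<partial>count_space C)" for \<tau> \<sigma>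
  proof (cases "(\<tau>, \<sigma>) \<in> S")
    case True
    then have sg: "0 < \<sigma>" "\<sigma> \<le> R" by (auto simp: S_def)
    obtain j where j: "j \<in> C" "cball (a (\<tau>,\<sigma>)) (r (\<tau>,\<sigma>)) \<subseteq> ball (a j) (5 * r j)"
      using cov[OF True] by auto
    then have sub: "{\<tau>..\<tau>+\<sigma>} \<subseteq> ball (a j) (5 * r j)" unfolding J J_def by simp
    have "\<tau> \<in> ball (a j) (5 * r j)" "\<tau> + \<sigma> \<in> ball (a j) (5 * r j)"
      by (rule subsetD[OF sub], use sg in simp)+
    moreover from this have "\<sigma> \<le> 5 * snd j"
      unfolding mem_ball dist_real_def r_def by linarith
    ultimately have t: "\<tau> \<in> ball (a j) (5 * r j)" "\<sigma> \<le> 5 * snd j" by auto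
    have "ennreal (\<sigma> ^ m) \<le> f j \<tau> \<sigma>"
    proof -
      have "\<sigma> ^ m \<le> (5 * snd j) ^ m" using t sg by (intro power_mono) auto
      with t sg show ?thesis by (simp add: f_def ennreal_leI)
    qed
    also have "\<dots> \<le> (\<integral>\<^sup>+j. f j \<tau> \<sigma> \<partial>count_space C)"
      by (rule nn_integral_ge_point[OF j(1)])
    finally show ?thesis using True sg by (simp add: S_def)
  next
    case False
    then show ?thesis by (auto simp: S_def indicator_def)
  qed
  define c where "c = ennreal (5 ^ (m + 2))"
  have "(\<integral>\<^sup>+\<tau>. \<integral>\<^sup>+\<sigma>. ennreal (\<sigma> ^ m) * indicator {0<..R} \<sigma> *
            (if ennreal (\<sigma> ^ (m + 2)) < (\<integral>\<^sup>+s\<in>{\<tau>..\<tau> + \<sigma>}. v s \<partial>lborel) then 1 else 0) \<partial>lborel \<partial>lborel)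
     \<le> (\<integral>\<^sup>+\<tau>. \<integral>\<^sup>+\<sigma>. \<integral>\<^sup>+j. f j \<tau> \<sigma> \<partial>count_space C \<partial>lborel \<partial>lborel)"
    by (intro nn_integral_mono pt)
  also have "\<dots> = (\<integral>\<^sup>+\<tau>. \<integral>\<^sup>+j. \<integral>\<^sup>+\<sigma>. f j \<tau> \<sigma> \<partial>lborel \<partial>count_space C \<partial>lborel)"
    by (subst nn_integral_count_space_nn_integral[OF C(1)]) (simp_all add: f_def[abs_def])
  also have "\<dots> = (\<integral>\<^sup>+\<tau>. \<integral>\<^sup>+j. ennreal ((5 * snd j) ^ m) * ennreal (5 * snd j) * indicator (ball (a j) (5 * r j)) \<tau> \<partial>count_space C \<partial>lborel)"
  proof (intro nn_integral_cong)
    fix \<tau> :: real and j assume "j \<in> space (count_space C)"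
    then have "snd j > 0" using pos by simp
    then show "(\<integral>\<^sup>+\<sigma>. f j \<tau> \<sigma> \<partial>lborel) = ennreal ((5 * snd j) ^ m) * ennreal (5 * snd j) * indicator (ball (a j) (5 * r j)) \<tau>"
      unfolding f_def by (subst nn_integral_cmult) (auto simp: mult_ac)
  qed
  also have "\<dots> = (\<integral>\<^sup>+j. \<integral>\<^sup>+\<tau>. ennreal ((5 * snd j) ^ m) * ennreal (5 * snd j) * indicator (ball (a j) (5 * r j)) \<tau> \<partial>lborel \<partial>count_space C)"
    by (rule nn_integral_count_space_nn_integral[OF C(1)]) simp
  also have "\<dots> \<le> (\<integral>\<^sup>+j. c * emeasure (density lborel v) (J j) \<partial>count_space C)"
  proof (rule nn_integral_mono)
    fix j assume "j \<in> space (count_space C)"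
    then have jC: "j \<in> C" by simp
    then have jS: "j \<in> S" and p: "snd j > 0" using C(2) pos by auto
    have "emeasure lborel (ball (a j) (5 * r j)) = ennreal (5 * snd j)"
      using p by (simp add: ball_eq_greaterThanLessThan r_def)
    then have "(\<integral>\<^sup>+\<tau>. ennreal ((5 * snd j) ^ m) * ennreal (5 * snd j) * indicator (ball (a j) (5 * r j)) \<tau> \<partial>lborel)
        = ennreal ((5 * snd j) ^ m) * ennreal (5 * snd j) * ennreal (5 * snd j)"
      by (subst nn_integral_cmult_indicator) simp_all
    also have "\<dots> = c * ennreal (snd j ^ (m + 2))"
      using p by (simp add: c_def ennreal_mult[symmetric] power_mult_distrib power2_eq_square power_add mult_ac)
    also have "\<dots> \<le> c * emeasure (density lborel v) (J j)"
      using jS by (intro mult_left_mono) (auto simp: S_def emeasure_density J_def)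
    finally show "(\<integral>\<^sup>+\<tau>. ennreal ((5 * snd j) ^ m) * ennreal (5 * snd j) * indicator (ball (a j) (5 * r j)) \<tau> \<partial>lborel)
        \<le> c * emeasure (density lborel v) (J j)" .
  qed
  also have "\<dots> = c * (\<integral>\<^sup>+j. emeasure (density lborel v) (J j) \<partial>count_space C)"
    by (rule nn_integral_cmult) simp
  also have "(\<integral>\<^sup>+j. emeasure (density lborel v) (J j) \<partial>count_space C) = emeasure (density lborel v) (\<Union>j\<in>C. J j)"
  proof (rule emeasure_UN_countable[symmetric, OF _ C(1)])
    show "disjoint_family_on J C" unfolding disjoint_family_on_def
      using pairwiseD[OF C(3), unfolded disjnt_def J] by blast
  qed (simp add: J_def)
  also have "c * \<dots> \<le> c * emeasure (density lborel v) UNIV"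
    by (intro mult_left_mono emeasure_mono) auto
  also have "emeasure (density lborel v) UNIV = (\<integral>\<^sup>+s. v s \<partial>lborel)"
    by (simp add: emeasure_density)
  finally show ?thesis by (simp add: c_def)
qed

text \<open>
The previous estimate on every line in direction h. Instead of decomposing the space into lines, the integral over x is
averaged over the translations by \<tau> h with \<tau> in [0, R]; the intervals in question then lie in [0, 2 R], which accounts
for the factor 2.
\<close>

lemma ray_average_bound:
  fixes u :: "'a::euclidean_space \<Rightarrow> ennreal"
  assumes [measurable]: "u \<in> borel_measurable borel" and R: "R > 0"
  shows "(\<integral>\<^sup>+x. \<integral>\<^sup>+\<sigma>. ennreal (\<sigma> ^ m) * indicator {0<..R} \<sigma> *
            (if ennreal (\<sigma> ^ (m + 2)) < (\<integral>\<^sup>+s\<in>{0..\<sigma>}. u (x + s *\<^sub>R h) \<partial>lborel) then 1 else 0) \<partial>lborel \<partial>lborel)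
         \<le> ennreal (2 * 5 ^ (m + 2)) * (\<integral>\<^sup>+x. u x \<partial>lborel)"
proof -
  define \<Phi> where "\<Phi> x = (\<integral>\<^sup>+\<sigma>. ennreal (\<sigma> ^ m) * indicator {0<..R} \<sigma> *
            (if ennreal (\<sigma> ^ (m + 2)) < (\<integral>\<^sup>+s\<in>{0..\<sigma>}. u (x + s *\<^sub>R h) \<partial>lborel) then 1 else 0) \<partial>lborel)" for x
  have [measurable]: "(\<lambda>z. \<integral>\<^sup>+s\<in>{0..snd z}. u (fst z + s *\<^sub>R h) \<partial>lborel) \<in> borel_measurable (borel \<Otimes>\<^sub>M lborel)"
  proof -
    have "(\<lambda>z. \<integral>\<^sup>+s. u (fst z + s *\<^sub>R h) * (if 0 \<le> s \<and> s \<le> snd z then 1 else 0) \<partial>lborel) \<in> borel_measurable (borel \<Otimes>\<^sub>M lborel)"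
      by measurable
    then show ?thesis by (simp add: indicator_def if_distrib cong: if_cong)
  qed
  have \<Phi>_meas[measurable]: "\<Phi> \<in> borel_measurable borel"
  proof -
    have "(\<lambda>x. \<integral>\<^sup>+\<sigma>. ennreal (\<sigma> ^ m) * indicator {0<..R} \<sigma> *
            (if ennreal (\<sigma> ^ (m + 2)) < (\<lambda>z. \<integral>\<^sup>+s\<in>{0..snd z}. u (fst z + s *\<^sub>R h) \<partial>lborel) (x, \<sigma>) then 1 else 0) \<partial>lborel)
        \<in> borel_measurable borel"
      by measurable
    then show ?thesis by (simp add: \<Phi>_def[abs_def])
  qed
  have "ennreal R * (\<integral>\<^sup>+x. \<Phi> x \<partial>lborel) = (\<integral>\<^sup>+\<tau>\<in>{0..R}. (\<integral>\<^sup>+x. \<Phi> x \<partial>lborel) \<partial>lborel)"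
    using R by (subst nn_integral_cmult_indicator) (simp_all add: mult.commute)
  also have "\<dots> = (\<integral>\<^sup>+\<tau>. \<integral>\<^sup>+x. \<Phi> (x + \<tau> *\<^sub>R h) * indicator {0..R} \<tau> \<partial>lborel \<partial>lborel)"
    by (simp add: nn_integral_multc nn_integral_lborel_translate)
  also have "\<dots> = (\<integral>\<^sup>+x. \<integral>\<^sup>+\<tau>. \<Phi> (x + \<tau> *\<^sub>R h) * indicator {0..R} \<tau> \<partial>lborel \<partial>lborel)"
    by (rule lborel_pair.Fubini') simp
  also have "\<dots> \<le> (\<integral>\<^sup>+x. ennreal (5 ^ (m + 2)) * (\<integral>\<^sup>+s. u (x + s *\<^sub>R h) * indicator {0..2 * R} s \<partial>lborel) \<partial>lborel)"
  proof (rule nn_integral_mono)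
    fix x :: 'a
    define v where "v s = u (x + s *\<^sub>R h) * indicator {0..2 * R} s" for s :: real
    have [measurable]: "v \<in> borel_measurable borel" unfolding v_def by measurable
    have "(\<integral>\<^sup>+\<tau>. \<Phi> (x + \<tau> *\<^sub>R h) * indicator {0..R} \<tau> \<partial>lborel)
      \<le> (\<integral>\<^sup>+\<tau>. \<integral>\<^sup>+\<sigma>. ennreal (\<sigma> ^ m) * indicator {0<..R} \<sigma> *
            (if ennreal (\<sigma> ^ (m + 2)) < (\<integral>\<^sup>+s\<in>{\<tau>..\<tau> + \<sigma>}. v s \<partial>lborel) then 1 else 0) \<partial>lborel \<partial>lborel)"
    proof (rule nn_integral_mono)
      fix \<tau> :: real
      show "\<Phi> (x + \<tau> *\<^sub>R h) * indicator {0..R} \<tau> \<le> (\<integral>\<^sup>+\<sigma>. ennreal (\<sigma> ^ m) * indicator {0<..R} \<sigma> *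
            (if ennreal (\<sigma> ^ (m + 2)) < (\<integral>\<^sup>+s\<in>{\<tau>..\<tau> + \<sigma>}. v s \<partial>lborel) then 1 else 0) \<partial>lborel)"
      proof (cases "\<tau> \<in> {0..R}")
        case True
        have eq: "(\<integral>\<^sup>+s\<in>{0..\<sigma>}. u (x + \<tau> *\<^sub>R h + s *\<^sub>R h) \<partial>lborel) = (\<integral>\<^sup>+s\<in>{\<tau>..\<tau> + \<sigma>}. v s \<partial>lborel)"
          if "\<sigma> \<in> {0<..R}" for \<sigma>
        proof -
          have "(\<integral>\<^sup>+s\<in>{0..\<sigma>}. u (x + \<tau> *\<^sub>R h + s *\<^sub>R h) \<partial>lborel)
             = (\<integral>\<^sup>+s. (v (s + \<tau>) * indicator {\<tau>..\<tau> + \<sigma>} (s + \<tau>)) \<partial>lborel)"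
            using True that
            by (intro nn_integral_cong) (auto simp: v_def indicator_def scaleR_add_left add_ac)
          also have "\<dots> = (\<integral>\<^sup>+s\<in>{\<tau>..\<tau> + \<sigma>}. v s \<partial>lborel)"
            by (rule nn_integral_lborel_translate) simp
          finally show ?thesis .
        qed
        have "ennreal (\<sigma> ^ m) * indicator {0<..R} \<sigma> *
            (if ennreal (\<sigma> ^ (m + 2)) < (\<integral>\<^sup>+s\<in>{0..\<sigma>}. u (x + \<tau> *\<^sub>R h + s *\<^sub>R h) \<partial>lborel) then 1 else 0)
          = ennreal (\<sigma> ^ m) * indicator {0<..R} \<sigma> *
            (if ennreal (\<sigma> ^ (m + 2)) < (\<integral>\<^sup>+s\<in>{\<tau>..\<tau> + \<sigma>}. v s \<partial>lborel) then 1 else 0)" for \<sigma>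
        proof (cases "\<sigma> \<in> {0<..R}")
          case True
          then show ?thesis by (simp only: eq)
        next
          case False
          show ?thesis unfolding indicator_simps(2)[OF False] by simp
        qed
        then show ?thesis unfolding \<Phi>_def using True by simp
      qed simp
    qed
    also have "\<dots> \<le> ennreal (5 ^ (m + 2)) * (\<integral>\<^sup>+s. v s \<partial>lborel)"
      by (rule interval_selection_bound) simp
    finally show "(\<integral>\<^sup>+\<tau>. \<Phi> (x + \<tau> *\<^sub>R h) * indicator {0..R} \<tau> \<partial>lborel) \<le>
      ennreal (5 ^ (m + 2)) * (\<integral>\<^sup>+s. u (x + s *\<^sub>R h) * indicator {0..2 * R} s \<partial>lborel)"
      by (simp add: v_def)
  qed
  also have "\<dots> = ennreal (5 ^ (m + 2)) * (\<integral>\<^sup>+x. \<integral>\<^sup>+s. u (x + s *\<^sub>R h) * indicator {0..2 * R} s \<partial>lborel \<partial>lborel)"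
    by (rule nn_integral_cmult) simp
  also have "(\<integral>\<^sup>+x. \<integral>\<^sup>+s. u (x + s *\<^sub>R h) * indicator {0..2 * R} s \<partial>lborel \<partial>lborel)
      = (\<integral>\<^sup>+s. \<integral>\<^sup>+x. u (x + s *\<^sub>R h) * indicator {0..2 * R} s \<partial>lborel \<partial>lborel)"
    by (rule lborel_pair.Fubini') simp
  also have "\<dots> = (\<integral>\<^sup>+s. (\<integral>\<^sup>+x. u x \<partial>lborel) * indicator {0..2 * R} s \<partial>lborel)"
    by (simp add: nn_integral_multc nn_integral_lborel_translate)
  also have "\<dots> = (\<integral>\<^sup>+x. u x \<partial>lborel) * ennreal (2 * R)"
    using R by (subst nn_integral_cmult_indicator) simp_all
  finally have main: "ennreal R * (\<integral>\<^sup>+x. \<Phi> x \<partial>lborel) \<le> ennreal (5 ^ (m + 2)) * ((\<integral>\<^sup>+x. u x \<partial>lborel) * ennreal (2 * R))" .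
  have one: "ennreal (1 / R) * ennreal R = 1" using R by (simp add: ennreal_mult[symmetric])
  have "(\<integral>\<^sup>+x. \<Phi> x \<partial>lborel) = ennreal (1 / R) * (ennreal R * (\<integral>\<^sup>+x. \<Phi> x \<partial>lborel))"
    by (simp only: mult.assoc[symmetric] one mult_1)
  also have "\<dots> \<le> ennreal (1 / R) * (ennreal (5 ^ (m + 2)) * ((\<integral>\<^sup>+x. u x \<partial>lborel) * ennreal (2 * R)))"
    by (rule mult_left_mono[OF main]) simp
  also have "\<dots> = (ennreal (1 / R) * ennreal (5 ^ (m + 2)) * ennreal (2 * R)) * (\<integral>\<^sup>+x. u x \<partial>lborel)"
    by (simp only: mult_ac)
  also have "ennreal (1 / R) * ennreal (5 ^ (m + 2)) * ennreal (2 * R) = ennreal (1 / R * 5 ^ (m + 2) * (2 * R))"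
    using R ennreal_mult[of "1 / R * 5 ^ (m + 2)" "2 * R"] ennreal_mult[of "1 / R" "5 ^ (m + 2)"]
    by simp
  also have "1 / R * 5 ^ (m + 2) * (2 * R) = 2 * 5 ^ (m + 2)" using R by simp
  finally show ?thesis by (simp add: \<Phi>_def)
qed

text \<open>
Writing h as \<sigma> times a vector of the shell 1 \<le> |h| \<le> 2 reduces the claim to one direction. There the condition says that
a segment of parameter length \<sigma> carries more than \<sigma>^(n+1), with n = m + 1. The bound B of u
keeps the relevant \<sigma> bounded, because \<sigma>^n cannot exceed it.
\<close>

lemma segment_average_superlevel_bound:
  fixes u :: "'a::euclidean_space \<Rightarrow> ennreal"
  assumes [measurable]: "u \<in> borel_measurable borel" and B: "\<And>x. u x \<le> ennreal B" and m: "DIM('a) = Suc m"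
  shows "(\<integral>\<^sup>+h. \<integral>\<^sup>+x. (if ennreal (norm h ^ Suc m) < (\<integral>\<^sup>+t\<in>{0..1}. u (x + t *\<^sub>R h) \<partial>lborel) then 1 else 0) \<partial>lborel \<partial>lborel)
     \<le> ennreal (4 * 5 ^ (m + 2) * measure lborel (cball (0::'a) 2)) * (\<integral>\<^sup>+x. u x \<partial>lborel)"
proof -
  define W where "W x h = (\<integral>\<^sup>+t\<in>{0..1}. u (x + t *\<^sub>R h) \<partial>lborel)" for x h
  define F where "F x h = (if ennreal (norm h ^ Suc m) < W x h then 1 else 0 :: ennreal)" for x h
  define R where "R = max 1 B"
  have R: "R > 0" by (simp add: R_def)
  have W_meas[measurable]: "(\<lambda>z. W (fst z) (snd z)) \<in> borel_measurable (borel \<Otimes>\<^sub>M borel)"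
    unfolding W_def by measurable
  have F_meas[measurable]: "(\<lambda>z. F (fst z) (snd z)) \<in> borel_measurable (borel \<Otimes>\<^sub>M borel)"
    unfolding F_def by measurable
  have F_comp[measurable]: "(\<lambda>z. F (f z) (g z)) \<in> borel_measurable M"
    if [measurable]: "f \<in> borel_measurable M" "g \<in> borel_measurable M" for f g and M :: "'b measure"
    using measurable_compose[OF measurable_Pair[OF that] F_meas] by simp
  define G where "G h = (\<integral>\<^sup>+x. F x h \<partial>lborel)" for h
  have [measurable]: "G \<in> borel_measurable borel"
  proof -
    have "(\<lambda>h. \<integral>\<^sup>+x. (\<lambda>z. F (fst z) (snd z)) (x, h) \<partial>lborel) \<in> borel_measurable borel" by measurable
    then show ?thesis by (simp add: G_def[abs_def])
  qed
  define c where "c = ennreal (2 * 5 ^ (m + 2)) * (\<integral>\<^sup>+x. u x \<partial>lborel)"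
  have inner: "(\<integral>\<^sup>+\<sigma>. indicator {1..2} (norm h) * (ennreal (\<sigma> ^ m) * indicator {0<..} \<sigma> * G (\<sigma> *\<^sub>R h)) \<partial>lborel)
     \<le> c * indicator (cball 0 2) h" for h
  proof (cases "norm h \<in> {1..2}")
    case True
    have ptw: "ennreal (\<sigma> ^ m) * indicator {0<..} \<sigma> * F x (\<sigma> *\<^sub>R h) \<le> ennreal (\<sigma> ^ m) * indicator {0<..R} \<sigma> *
            (if ennreal (\<sigma> ^ (m + 2)) < (\<integral>\<^sup>+s\<in>{0..\<sigma>}. u (x + s *\<^sub>R h) \<partial>lborel) then 1 else 0)" for x \<sigma>
    proof (cases "\<sigma> > 0 \<and> ennreal (norm (\<sigma> *\<^sub>R h) ^ Suc m) < W x (\<sigma> *\<^sub>R h)")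
      case True
      then have s: "\<sigma> > 0" and lt: "ennreal (norm (\<sigma> *\<^sub>R h) ^ Suc m) < W x (\<sigma> *\<^sub>R h)" by auto
      have "\<sigma> * 1 \<le> \<sigma> * norm h" using s \<open>norm h \<in> {1..2}\<close> by (intro mult_left_mono) auto
      then have "\<sigma> ^ Suc m \<le> norm (\<sigma> *\<^sub>R h) ^ Suc m" using s by (intro power_mono) auto
      then have lt': "ennreal (\<sigma> ^ Suc m) < W x (\<sigma> *\<^sub>R h)"
        using lt by (meson ennreal_leI le_less_trans)
      have "W x (\<sigma> *\<^sub>R h) \<le> (\<integral>\<^sup>+t\<in>{0..1::real}. ennreal B \<partial>lborel)"
        unfolding W_def by (intro nn_integral_mono mult_right_mono B) simp
      also have "\<dots> = ennreal B" by (subst nn_integral_cmult_indicator) simp_all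
      finally have "ennreal (\<sigma> ^ Suc m) < ennreal B" using lt' by (rule order.strict_trans2[rotated])
      then have "\<sigma> ^ Suc m < B" using s by (simp add: ennreal_less_iff)
      then have "\<sigma> \<le> R"
      proof (cases "\<sigma> \<le> 1")
        case False
        then have "\<sigma> \<le> \<sigma> ^ Suc m" by (intro self_le_power) auto
        with \<open>\<sigma> ^ Suc m < B\<close> show ?thesis by (simp add: R_def)
      qed (simp add: R_def)
      have "ennreal (\<sigma> ^ (m + 2)) = ennreal \<sigma> * ennreal (\<sigma> ^ Suc m)"
        using s by (simp add: ennreal_mult[symmetric])
      also have "\<dots> < ennreal \<sigma> * W x (\<sigma> *\<^sub>R h)"
        using lt' s by (simp add: ennreal_mult_strict_left_mono)
      also have "\<dots> = (\<integral>\<^sup>+s\<in>{0..\<sigma>}. u (x + s *\<^sub>R h) \<partial>lborel)"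
      proof -
        have "(\<integral>\<^sup>+s\<in>{0..\<sigma>}. u (x + s *\<^sub>R h) \<partial>lborel) =
           ennreal \<sigma> * (\<integral>\<^sup>+t. u (x + (\<sigma> *\<^sub>R t) *\<^sub>R h) * indicator {0..\<sigma>} (\<sigma> *\<^sub>R t) \<partial>lborel)"
          by (subst nn_integral_lborel_scale[OF _ s]) simp_all
        also have "(\<integral>\<^sup>+t. u (x + (\<sigma> *\<^sub>R t) *\<^sub>R h) * indicator {0..\<sigma>} (\<sigma> *\<^sub>R t) \<partial>lborel) = W x (\<sigma> *\<^sub>R h)"
          unfolding W_def using s
          by (intro nn_integral_cong) (auto simp: indicator_def mult.commute zero_le_mult_iff)
        finally show ?thesis ..
      qed
      finally show ?thesis using s \<open>\<sigma> \<le> R\<close> by (simp add: F_def)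
    qed (auto simp: F_def indicator_def)
    have "(\<integral>\<^sup>+\<sigma>. ennreal (\<sigma> ^ m) * indicator {0<..} \<sigma> * G (\<sigma> *\<^sub>R h) \<partial>lborel)
       = (\<integral>\<^sup>+\<sigma>. \<integral>\<^sup>+x. ennreal (\<sigma> ^ m) * indicator {0<..} \<sigma> * F x (\<sigma> *\<^sub>R h) \<partial>lborel \<partial>lborel)"
      unfolding G_def by (intro nn_integral_cong nn_integral_cmult[symmetric]) measurable
    also have "\<dots> = (\<integral>\<^sup>+x. \<integral>\<^sup>+\<sigma>. ennreal (\<sigma> ^ m) * indicator {0<..} \<sigma> * F x (\<sigma> *\<^sub>R h) \<partial>lborel \<partial>lborel)"
      by (rule lborel_pair.Fubini') (simp add: split_beta')
    also have "\<dots> \<le> c"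
      unfolding c_def by (rule order_trans[OF _ ray_average_bound[OF _ R, of u m h]])
        (intro nn_integral_mono ptw, simp)
    finally show ?thesis using True by simp
  qed simp
  have "(\<integral>\<^sup>+h. G h \<partial>lborel) \<le> ennreal 2 * (\<integral>\<^sup>+h. \<integral>\<^sup>+\<sigma>. indicator {1..2} (norm h) * (ennreal (\<sigma> ^ m) * indicator {0<..} \<sigma> * G (\<sigma> *\<^sub>R h)) \<partial>lborel \<partial>lborel)"
    by (rule nn_integral_le_radial[OF _ m]) simp
  also have "\<dots> \<le> ennreal 2 * (\<integral>\<^sup>+h. c * indicator (cball 0 2) (h::'a) \<partial>lborel)"
    by (intro mult_left_mono nn_integral_mono inner) simp
  also have "(\<integral>\<^sup>+h. c * indicator (cball 0 2) (h::'a) \<partial>lborel) = c * emeasure lborel (cball (0::'a) 2)"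
    by (rule nn_integral_cmult_indicator) simp
  also have "emeasure lborel (cball (0::'a) 2) = ennreal (measure lborel (cball (0::'a) 2))"
    by (rule emeasure_eq_ennreal_measure) (use emeasure_lborel_cball_finite[of "0::'a" 2] in auto)
  also have "ennreal 2 * (c * ennreal (measure lborel (cball (0::'a) 2))) =
      ennreal 2 * ennreal (2 * 5 ^ (m + 2)) * ennreal (measure lborel (cball (0::'a) 2)) * (\<integral>\<^sup>+x. u x \<partial>lborel)"
    by (simp only: c_def mult_ac)
  also have "ennreal 2 * ennreal (2 * 5 ^ (m + 2)) * ennreal (measure lborel (cball (0::'a) 2))
     = ennreal (4 * 5 ^ (m + 2) * measure lborel (cball (0::'a) 2))"
    by (subst ennreal_mult[symmetric] | simp)+
  finally show ?thesis by (simp add: G_def F_def W_def)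
qed

section \<open>Bounds for the weak energy\<close>

text \<open>
It replaces Jensen's inequality: integrated over [0, 1], it shows that if the average of L exceeds a then the average
of L powr p exceeds (a/2) powr p.
\<close>

lemma le_half_add_powr:
  fixes L a p :: real
  assumes "p \<ge> 1" "a > 0" "L \<ge> 0"
  shows "L \<le> a / 2 + (a / 2) powr (1 - p) * L powr p"
proof (cases "L \<le> a / 2")
  case True
  then show ?thesis by (simp add: add_increasing2)
next
  case False
  then have L: "L > a / 2" "L > 0" using assms by auto
  have "L = L powr (1 - p) * L powr p" using L by (simp flip: powr_add)
  also have "\<dots> \<le> (a / 2) powr (1 - p) * L powr p"
    using L assms by (intro mult_right_mono powr_mono2') auto
  finally show ?thesis using assms by (simp add: add_increasing)
qed

lemma quotient_level_set_measurable:
  fixes f :: "real ^ 'n \<Rightarrow> real"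
  assumes f: "continuous_on UNIV f"
  shows "{(x, y). \<bar>f x - f y\<bar> / rho A x y powr q > \<mu>} \<in> sets (lborel \<Otimes>\<^sub>M lborel)"
proof -
  have [measurable]: "f \<in> borel_measurable borel" by (rule borel_measurable_continuous_onI[OF f])
  have "continuous_on UNIV (\<lambda>z. rho A (fst z) (snd z))"
    unfolding rho_def infnorm_def
    by (intro continuous_intros continuous_on_infnorm[unfolded infnorm_def] matrix_vector_mult_linear_continuous_on[THEN continuous_on_compose2]) auto
  then have [measurable]: "(\<lambda>z. rho A (fst z) (snd z)) \<in> borel_measurable (lborel \<Otimes>\<^sub>M lborel)"
    by (simp add: borel_measurable_continuous_onI lborel_prod)
  have "{z \<in> space (lborel \<Otimes>\<^sub>M lborel). \<bar>f (fst z) - f (snd z)\<bar> / rho A (fst z) (snd z) powr q > \<mu>}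
      \<in> sets (lborel \<Otimes>\<^sub>M lborel)"
    by measurable
  then show ?thesis by (simp add: case_prod_unfold space_pair_measure)
qed

text \<open>
For a pair (x, x + h) of the level set at height \<mu> the average of Lip f over the segment exceeds a = 2 b |h|^(n/p) with
b proportional to \<mu>, hence the average of (Lip f / b)^p exceeds |h|^n. The superlevel bound yields the factor b^(-p), which
cancels \<mu>^p.
\<close>

lemma weak_energy_le_Lip:
  fixes f :: "real ^ 'n \<Rightarrow> real" and A :: "real ^ 'n ^ 'n"
  assumes p: "p \<ge> 1" and c: "c > 0" and A: "\<And>h. c * norm h \<le> infnorm (A *v h)"
    and L: "L-lipschitz_on UNIV f" and cont: "continuous_on UNIV (Lip f)" and B: "\<And>z. Lip f z \<le> B"
  shows "weak_energy p A f \<le> ennreal ((2 / c powr (1 + CARD('n) / p)) powr p *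
     (4 * 5 ^ (CARD('n) + 1) * measure lborel (cball (0::real ^ 'n) 2))) * (\<integral>\<^sup>+x. ennreal (Lip f x powr p) \<partial>lborel)"
proof -
  define q where "q = 1 + CARD('n) / p"
  define K where "K = 4 * 5 ^ (CARD('n) + 1) * measure lborel (cball (0::real ^ 'n) 2)"
  have K0: "K \<ge> 0" by (simp add: K_def)
  define I where "I = (\<integral>\<^sup>+x. ennreal (Lip f x powr p) \<partial>lborel)"
  have fc: "continuous_on UNIV f" using L by (rule lipschitz_on_continuous_on)
  have Lip0: "0 \<le> Lip f z" for z by (rule ereal_Lip(2)[OF L])
  have [measurable]: "Lip f \<in> borel_measurable borel" by (rule borel_measurable_continuous_onI[OF cont])
  obtain m where m: "CARD('n) = Suc m" by (metis Suc_pred zero_less_card_finite)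
  have "ennreal (\<mu> powr p) * (\<integral>\<^sup>+ z. indicator {(x, y). \<bar>f x - f y\<bar> / rho A x y powr q > \<mu>} z
          \<partial>(lborel \<Otimes>\<^sub>M lborel)) \<le> ennreal ((2 / c powr q) powr p * K) * I" if \<mu>: "\<mu> > 0" for \<mu>
  proof -
    define S where "S = {(x, y). \<bar>f x - f y\<bar> / rho A x y powr q > \<mu>}"
    have S[measurable]: "S \<in> sets (lborel \<Otimes>\<^sub>M lborel)"
      unfolding S_def by (rule quotient_level_set_measurable[OF fc])
    have S'[measurable]: "S \<in> sets (borel \<Otimes>\<^sub>M borel)" using S by simp
    define b where "b = \<mu> * c powr q / 2"
    have b: "b > 0" using \<mu> c by (simp add: b_def)
    define u where "u z = ennreal ((Lip f z / b) powr p)" for z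
    have [measurable]: "u \<in> borel_measurable borel" unfolding u_def by measurable
    have uB: "u z \<le> ennreal ((B / b) powr p)" for z
      unfolding u_def using Lip0 B b p by (intro ennreal_leI powr_mono2 divide_right_mono) auto
    have key: "ennreal (norm h ^ Suc m) < (\<integral>\<^sup>+t\<in>{0..1}. u (x + t *\<^sub>R h) \<partial>lborel)"
      if xh: "(x, x + h) \<in> S" for x h
    proof -
      have S1: "\<mu> < \<bar>f x - f (x + h)\<bar> / rho A x (x + h) powr q" using xh by (simp add: S_def)
      have rho: "rho A x (x + h) = infnorm (A *v h)"
        using infnorm_neg[of "A *v h"] by (simp add: rho_def vec.neg)
      have h: "h \<noteq> 0" using S1 \<mu> by auto
      then have nh: "norm h > 0" by simp
      have cn: "0 < c * norm h" using c nh by simp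
      have rp: "rho A x (x + h) > 0" unfolding rho using A[of h] cn by linarith
      have "\<mu> * (c * norm h) powr q \<le> \<mu> * rho A x (x + h) powr q"
        unfolding rho using \<mu> p A[of h] cn by (intro mult_left_mono powr_mono2) (auto simp: q_def)
      also have "\<dots> < \<bar>f x - f (x + h)\<bar>" using S1 rp by (simp add: field_simps)
      also have "\<dots> \<le> norm h * integral {0..1} (\<lambda>t. Lip f (x + t *\<^sub>R h))"
        using increment_le_integral_Lip[OF L cont, of x h] by (simp add: abs_minus_commute)
      finally have 1: "\<mu> * (c * norm h) powr q < norm h * integral {0..1} (\<lambda>t. Lip f (x + t *\<^sub>R h))" .
      define a where "a = 2 * b * norm h powr (CARD('n) / p)"
      have a: "a > 0" using b nh by (simp add: a_def)
      have "\<mu> * (c * norm h) powr q = norm h * a"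
        using nh c by (simp add: a_def b_def powr_mult q_def powr_add)
      with 1 nh have 2: "a < integral {0..1} (\<lambda>t. Lip f (x + t *\<^sub>R h))" by simp
      define w where "w t = Lip f (x + t *\<^sub>R h)" for t
      have wc: "continuous_on {0..1} w" unfolding w_def
        by (intro continuous_on_compose2[OF cont] continuous_intros) auto
      have wpc: "continuous_on {0..1} (\<lambda>t. w t powr p)"
        using p Lip0 by (intro continuous_on_powr' wc continuous_intros) (auto simp: w_def)
      have rc: "continuous_on {0..1} (\<lambda>t. (a / 2) powr (1 - p) * w t powr p)"
        by (rule continuous_on_mult[OF continuous_on_const wpc])
      have "integral {0..1} w \<le> integral {0..1} (\<lambda>t. a / 2 + (a / 2) powr (1 - p) * w t powr p)"
        using a p Lip0
        by (intro integral_le integrable_continuous_real continuous_on_add[OF continuous_on_const rc] wc le_half_add_powr)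
           (auto simp: w_def)
      also have "\<dots> = integral {0..1} (\<lambda>t::real. a / 2) + integral {0..1} (\<lambda>t. (a / 2) powr (1 - p) * w t powr p)"
        by (rule integral_add) (intro integrable_continuous_real continuous_on_const rc)+
      also have "\<dots> = a / 2 + (a / 2) powr (1 - p) * integral {0..1} (\<lambda>t. w t powr p)"
        by simp
      finally have "a / 2 < (a / 2) powr (1 - p) * integral {0..1} (\<lambda>t. w t powr p)"
        using 2 unfolding w_def[abs_def, symmetric] by linarith
      then have "(a / 2) powr (p - 1) * (a / 2) < (a / 2) powr (p - 1) * ((a / 2) powr (1 - p) * integral {0..1} (\<lambda>t. w t powr p))"
        using a by (intro mult_strict_left_mono) auto
      also have "\<dots> = integral {0..1} (\<lambda>t. w t powr p)"
        using a by (simp flip: mult.assoc powr_add)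
      also have "(a / 2) powr (p - 1) * (a / 2) = (a / 2) powr p"
        using a powr_add[of "a / 2" "p - 1" 1] by simp
      also have "(a / 2) powr p = b powr p * norm h ^ Suc m"
        using nh b p by (simp add: a_def powr_mult powr_powr m[symmetric] powr_realpow del: of_nat_Suc)
      finally have 3: "norm h ^ Suc m < integral {0..1} (\<lambda>t. w t powr p) / b powr p"
        using b by (simp add: field_simps)
      have "((\<lambda>t. (w t / b) powr p) has_integral integral {0..1} (\<lambda>t. w t powr p) / b powr p) {0..1}"
      proof -
        have "((\<lambda>t. w t powr p / b powr p) has_integral integral {0..1} (\<lambda>t. w t powr p) / b powr p) {0..1}"
          by (intro has_integral_divide integrable_integral integrable_continuous_real wpc)
        moreover have "w t powr p / b powr p = (w t / b) powr p" for t
          using b Lip0 by (simp add: powr_divide w_def)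
        ultimately show ?thesis by simp
      qed
      then have "(\<integral>\<^sup>+t. ennreal (indicator {0..1} t * (w t / b) powr p) \<partial>lborel) = ennreal (integral {0..1} (\<lambda>t. w t powr p) / b powr p)"
        by (intro nn_integral_has_integral_lebesgue) auto
      also have "(\<integral>\<^sup>+t. ennreal (indicator {0..1} t * (w t / b) powr p) \<partial>lborel) = (\<integral>\<^sup>+t\<in>{0..1}. u (x + t *\<^sub>R h) \<partial>lborel)"
        by (intro nn_integral_cong) (auto simp: u_def w_def indicator_def)
      finally have "(\<integral>\<^sup>+t\<in>{0..1}. u (x + t *\<^sub>R h) \<partial>lborel) = ennreal (integral {0..1} (\<lambda>t. w t powr p) / b powr p)" .
      then show ?thesis
        using ennreal_lessI[OF le_less_trans[OF zero_le_power[OF norm_ge_zero] 3] 3] by (simp only:)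
    qed
    have "(\<integral>\<^sup>+ z. indicator S z \<partial>(lborel \<Otimes>\<^sub>M lborel)) = (\<integral>\<^sup>+x. \<integral>\<^sup>+y. indicator S (x, y) \<partial>lborel \<partial>lborel)"
      by (rule lborel.nn_integral_fst[symmetric]) simp
    also have "\<dots> = (\<integral>\<^sup>+x. \<integral>\<^sup>+h. indicator S (x, h + x) \<partial>lborel \<partial>lborel)"
      by (intro nn_integral_cong nn_integral_lborel_translate[symmetric]) measurable
    also have "\<dots> = (\<integral>\<^sup>+h. \<integral>\<^sup>+x. indicator S (x, h + x) \<partial>lborel \<partial>lborel)"
      by (rule lborel_pair.Fubini') simp
    also have "\<dots> \<le> (\<integral>\<^sup>+h. \<integral>\<^sup>+x. (if ennreal (norm h ^ Suc m) < (\<integral>\<^sup>+t\<in>{0..1}. u (x + t *\<^sub>R h) \<partial>lborel) then 1 else 0) \<partial>lborel \<partial>lborel)"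
      using key by (intro nn_integral_mono) (auto simp: indicator_def add.commute)
    also have "\<dots> \<le> ennreal K * (\<integral>\<^sup>+x. u x \<partial>lborel)"
      using segment_average_superlevel_bound[where u = u and B = "(B / b) powr p" and m = m, OF _ uB]
        m[symmetric] by (simp add: K_def)
    also have "(\<integral>\<^sup>+x. u x \<partial>lborel) = ennreal ((1 / b) powr p) * I"
      unfolding I_def u_def using b Lip0
      by (subst nn_integral_cmult[symmetric])
         (auto intro!: nn_integral_cong simp: powr_divide ennreal_mult[symmetric])
    finally have "ennreal (\<mu> powr p) * (\<integral>\<^sup>+ z. indicator S z \<partial>(lborel \<Otimes>\<^sub>M lborel))
      \<le> ennreal (\<mu> powr p) * (ennreal K * (ennreal ((1 / b) powr p) * I))"
      by (rule mult_left_mono) simp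
    also have "\<dots> = (ennreal (\<mu> powr p) * (ennreal K * ennreal ((1 / b) powr p))) * I"
      by (simp only: mult.assoc)
    also have "ennreal (\<mu> powr p) * (ennreal K * ennreal ((1 / b) powr p)) = ennreal (\<mu> powr p * (K * (1 / b) powr p))"
      using K0 by (simp add: ennreal_mult)
    also have "\<mu> powr p * (K * (1 / b) powr p) = (2 / c powr q) powr p * K"
    proof -
      have "\<mu> powr p * (1 / b) powr p = (\<mu> * (1 / b)) powr p" using \<mu> b by (simp only: powr_mult)
      also have "\<mu> * (1 / b) = 2 / c powr q" using \<mu> c by (simp add: b_def)
      finally show ?thesis by (simp add: mult_ac)
    qed
    finally show ?thesis by (simp add: S_def)
  qed
  then show ?thesis
    unfolding weak_energy_def K_def[symmetric] I_def[symmetric] q_def[symmetric]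
    by (intro SUP_least) simp
qed

text \<open>
Fix x with gradient D \<noteq> 0 and let e = D / |D|. For y in the ball around x + (R/2) e of radius R/8 the vector y - x has
length less than 5R/8 and makes f grow by at least 7/32 R |D|, provided that R is small. The radius R = R k is chosen
such that the level times the denominator is at most 5/32 R |D| on this ball. The measure of the ball
times the p-th power of the level does not depend on k. So the lower limit of the
measurable functions E k bounds the integrand pointwise, and Fatou's lemma applies to it.
\<close>

lemma aniso_grad_le_weak_energy:
  fixes f :: "real ^ 'n \<Rightarrow> real" and A :: "real ^ 'n ^ 'n"
  assumes p: "p \<ge> 1" and c: "c > 0" and A: "\<And>h. infnorm (A *v h) \<le> c * norm h"
    and inj: "\<And>h. A *v h = 0 \<Longrightarrow> h = 0"
    and t: "t > 0" "\<And>h. norm (transpose A *v h) \<le> t * norm h"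
    and fc: "continuous_on UNIV f"
  shows "(\<integral>\<^sup>+x. ennreal (norm (aniso_grad A f x) powr p) \<partial>lborel) \<le>
    ennreal (t powr p * (8 ^ CARD('n) * (4 * c powr (1 + CARD('n) / p)) powr p / measure lborel (ball (0::real ^ 'n) 1))) * weak_energy p A f"
proof -
  define q where "q = 1 + CARD('n) / p"
  define \<omega> where "\<omega> = measure lborel (ball (0::real ^ 'n) 1)"
  define b where "b = 4 * c powr q"
  have b: "b > 0" using c by (simp add: b_def)
  have \<omega>: "\<omega> > 0" by (simp add: \<omega>_def content_ball_pos)
  define S where "S k = {(x, y). \<bar>f x - f y\<bar> / rho A x y powr q > real (Suc k)}" for k
  have S[measurable]: "S k \<in> sets (lborel \<Otimes>\<^sub>M lborel)" for k
    unfolding S_def by (rule quotient_level_set_measurable[OF fc])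
  have S'[measurable]: "S k \<in> sets (borel \<Otimes>\<^sub>M borel)" for k using S by simp
  define E where "E k x = ennreal (real (Suc k) powr p) * (\<integral>\<^sup>+y. indicator (S k) (x, y) \<partial>lborel)" for k x
  have [measurable]: "E k \<in> borel_measurable borel" for k
    unfolding E_def[abs_def] by measurable
  have E_le: "(\<integral>\<^sup>+x. E k x \<partial>lborel) \<le> weak_energy p A f" for k
  proof -
    have "(\<integral>\<^sup>+x. E k x \<partial>lborel) = ennreal (real (Suc k) powr p) * (\<integral>\<^sup>+x. \<integral>\<^sup>+y. indicator (S k) (x, y) \<partial>lborel \<partial>lborel)"
      unfolding E_def by (rule nn_integral_cmult) measurable
    also have "(\<integral>\<^sup>+x. \<integral>\<^sup>+y. indicator (S k) (x, y) \<partial>lborel \<partial>lborel) = (\<integral>\<^sup>+ z. indicator (S k) z \<partial>(lborel \<Otimes>\<^sub>M lborel))"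
      by (rule lborel.nn_integral_fst) simp
    also have "ennreal (real (Suc k) powr p) * \<dots> \<le> weak_energy p A f"
      unfolding weak_energy_def S_def q_def by (rule SUP_upper) simp
    finally show ?thesis .
  qed
  have grad_le: "ennreal (norm (grad f x) powr p) \<le> ennreal (8 ^ CARD('n) * b powr p / \<omega>) * liminf (\<lambda>k. E k x)" for x
  proof (cases "f differentiable (at x) \<and> grad f x \<noteq> 0")
    case True
    define D where "D = grad f x"
    have "GDERIV f x :> D" unfolding D_def using True by (intro GDERIV_grad) blast
    then have fD: "(f has_derivative (\<lambda>h. h \<bullet> D)) (at x)" by (simp add: gderiv_def)
    have D: "norm D > 0" using True by (simp add: D_def)
    then obtain \<delta> where \<delta>: "\<delta> > 0" "\<And>y. norm (y - x) < \<delta> \<Longrightarrow> \<bar>f y - f x - (y - x) \<bullet> D\<bar> \<le> norm D / 4 * norm (y - x)"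
      using fD unfolding has_derivative_at_alt by (metis real_norm_def divide_pos_pos zero_less_numeral)
    define R where "R k = (norm D / (b * real (Suc k))) powr (p / CARD('n))" for k
    have R0: "R k > 0" for k using D b by (simp add: R_def)
    have "R \<longlonglongrightarrow> 0"
    proof -
      have "(\<lambda>k. norm D / b * inverse (real (Suc k))) \<longlonglongrightarrow> norm D / b * 0"
        by (intro tendsto_intros LIMSEQ_inverse_real_of_nat)
      then have "(\<lambda>k. (norm D / b * inverse (real (Suc k))) powr (p / CARD('n))) \<longlonglongrightarrow> 0 powr (p / CARD('n))"
        using p by (intro tendsto_powr') (auto simp: D b less_imp_le intro!: always_eventually)
      then show ?thesis using p by (simp add: R_def[abs_def] divide_inverse mult.assoc)
    qed
    then have "\<forall>\<^sub>F k in sequentially. R k < \<delta>" using \<delta>(1) by (rule order_tendstoD)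
    then have "\<forall>\<^sub>F k in sequentially. ennreal (norm D powr p * (\<omega> / (8 ^ CARD('n) * b powr p))) \<le> E k x"
    proof eventually_elim
      case (elim k)
      define e where "e = D /\<^sub>R norm D"
      have e: "norm e = 1" "e \<bullet> D = norm D" using D by (simp_all add: e_def power2_norm_eq_inner[symmetric] power2_eq_square)
      have sub: "(x, y) \<in> S k" if y: "y \<in> ball (x + (R k / 2) *\<^sub>R e) (R k / 8)" for y
      proof -
        define w where "w = y - (x + (R k / 2) *\<^sub>R e)"
        have w: "norm w < R k / 8" using y by (simp add: w_def dist_norm norm_minus_commute)
        define h where "h = y - x"
        have h: "h = (R k / 2) *\<^sub>R e + w" by (simp add: h_def w_def)
        have n1: "norm ((R k / 2) *\<^sub>R e) = R k / 2" using e R0[of k] by simp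
        have hu: "norm h < 5 / 8 * R k" using norm_triangle_ineq[of "(R k / 2) *\<^sub>R e" w] w unfolding h n1 by linarith
        have hl: "norm h > 0"
          using norm_diff_ineq[of "(R k / 2) *\<^sub>R e" w] w R0[of k] unfolding h n1 by linarith
        have "\<bar>w \<bullet> D\<bar> \<le> norm w * norm D" by (rule Cauchy_Schwarz_ineq2)
        also have "\<dots> \<le> R k / 8 * norm D" using w by (intro mult_right_mono) auto
        finally have "3 / 8 * (R k * norm D) \<le> h \<bullet> D"
          by (simp add: h inner_add_left e)
        moreover have "\<bar>f y - f x - h \<bullet> D\<bar> \<le> norm D / 4 * norm h"
          using \<delta>(2)[of y] hu elim R0[of k] by (simp add: h_def)
        moreover have "norm D / 4 * norm h \<le> norm D / 4 * (5 / 8 * R k)"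
          using hu by (intro mult_left_mono) auto
        moreover have "norm D / 4 * (5 / 8 * R k) = 5 / 32 * (R k * norm D)" by simp
        ultimately have up: "7 / 32 * (R k * norm D) \<le> \<bar>f x - f y\<bar>" by linarith
        have rho: "rho A x y = infnorm (A *v h)"
          using infnorm_neg[of "A *v h"] by (simp add: rho_def h_def matrix_vector_mult_diff_distrib)
        have "h \<noteq> 0" using hl by auto
        then have rp: "rho A x y > 0" unfolding rho using inj by (auto simp: infnorm_pos_lt)
        have "real (Suc k) * rho A x y powr q \<le> real (Suc k) * (c * norm h) powr q"
          unfolding rho using A[of h] p by (intro mult_left_mono powr_mono2) (auto simp: q_def infnorm_pos_le)
        also have "\<dots> = real (Suc k) * (c powr q * (norm h * norm h powr (CARD('n) / p)))"
          using hl c by (simp add: q_def powr_mult powr_add)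
        also have "\<dots> \<le> real (Suc k) * (c powr q * (5 / 8 * R k * R k powr (CARD('n) / p)))"
          using hu R0[of k] p by (intro mult_left_mono mult_mono powr_mono2) auto
        also have "\<dots> = real (Suc k) * (c powr q * (5 / 8 * R k * (norm D / (b * real (Suc k)))))"
          using p D b by (simp add: R_def powr_powr)
        also have "\<dots> = 5 / 32 * (R k * norm D)"
        proof -
          have "s * (u * (5 / 8 * d * (d' / (4 * u * s)))) = 5 / 32 * (d * d')"
            if "s \<noteq> 0" "u \<noteq> 0" for s u d d' :: real
            using that by (simp add: field_simps)
          note this[of "real (Suc k)" "c powr q" "R k" "norm D"]
          moreover have "c powr q \<noteq> 0" using c by simp
          ultimately show ?thesis unfolding b_def by (metis of_nat_neq_0)
        qed
        also have "\<dots> < 7 / 32 * (R k * norm D)" using R0[of k] D by simp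
        also note up
        finally show ?thesis using rp by (simp add: S_def field_simps)
      qed
      have "ennreal (norm D powr p * (\<omega> / (8 ^ CARD('n) * b powr p))) = ennreal (real (Suc k) powr p) * ennreal ((R k / 8) ^ CARD('n) * \<omega>)"
      proof -
        have "R k ^ CARD('n) = R k powr CARD('n)" using R0[of k] by (simp add: powr_realpow)
        also have "\<dots> = norm D powr p / (b powr p * real (Suc k) powr p)"
          using D b by (simp add: R_def powr_powr powr_divide powr_mult del: of_nat_Suc)
        finally have "real (Suc k) powr p * ((R k / 8) ^ CARD('n) * \<omega>) = norm D powr p * (\<omega> / (8 ^ CARD('n) * b powr p))"
          by (simp add: power_divide field_simps del: of_nat_Suc)
        then show ?thesis using \<omega> R0[of k] by (simp add: ennreal_mult[symmetric] del: of_nat_Suc)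
      qed
      also have "ennreal ((R k / 8) ^ CARD('n) * \<omega>) = emeasure lborel (ball (x + (R k / 2) *\<^sub>R e) (R k / 8))"
      proof -
        have "emeasure lborel (ball (x + (R k / 2) *\<^sub>R e) (R k / 8)) = ennreal (measure lborel (ball (x + (R k / 2) *\<^sub>R e) (R k / 8)))"
          by (intro emeasure_eq_ennreal_measure less_imp_neq[OF emeasure_lborel_ball_finite[unfolded infinity_ennreal_def]])
        then show ?thesis using content_ball_conv_unit_ball[of "R k / 8" "x + (R k / 2) *\<^sub>R e"] R0[of k] by (simp add: \<omega>_def)
      qed
      also have "\<dots> = (\<integral>\<^sup>+y. indicator (ball (x + (R k / 2) *\<^sub>R e) (R k / 8)) y \<partial>lborel)" by simp
      also have "\<dots> \<le> (\<integral>\<^sup>+y. indicator (S k) (x, y) \<partial>lborel)"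
        using sub by (intro nn_integral_mono) (auto simp: indicator_def)
      finally show ?case by (simp add: E_def mult_left_mono)
    qed
    then have "ennreal (norm D powr p * (\<omega> / (8 ^ CARD('n) * b powr p))) \<le> liminf (\<lambda>k. E k x)"
      by (rule Liminf_bounded)
    then have "ennreal (8 ^ CARD('n) * b powr p / \<omega>) * ennreal (norm D powr p * (\<omega> / (8 ^ CARD('n) * b powr p)))
      \<le> ennreal (8 ^ CARD('n) * b powr p / \<omega>) * liminf (\<lambda>k. E k x)"
      by (rule mult_left_mono) simp
    also have "ennreal (8 ^ CARD('n) * b powr p / \<omega>) * ennreal (norm D powr p * (\<omega> / (8 ^ CARD('n) * b powr p))) = ennreal (norm D powr p)"
      using \<omega> b by (simp add: ennreal_mult[symmetric])
    finally show ?thesis by (simp add: D_def)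
  next
    case False
    then have "grad f x = 0" by (auto simp: grad_def)
    then show ?thesis by simp
  qed
  define M where "M = t powr p * (8 ^ CARD('n) * b powr p / \<omega>)"
  have ptw: "ennreal (norm (aniso_grad A f x) powr p) \<le> ennreal M * liminf (\<lambda>k. E k x)" for x
  proof -
    have "norm (aniso_grad A f x) powr p \<le> (t * norm (grad f x)) powr p"
      unfolding aniso_grad_def using t p by (intro powr_mono2) auto
    also have "\<dots> = t powr p * norm (grad f x) powr p" using t by (simp add: powr_mult)
    finally have "ennreal (norm (aniso_grad A f x) powr p) \<le> ennreal (t powr p) * ennreal (norm (grad f x) powr p)"
      by (simp add: ennreal_mult[symmetric] ennreal_leI)
    also have "\<dots> \<le> ennreal (t powr p) * (ennreal (8 ^ CARD('n) * b powr p / \<omega>) * liminf (\<lambda>k. E k x))"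
      by (intro mult_left_mono grad_le) simp
    also have "\<dots> = ennreal M * liminf (\<lambda>k. E k x)"
    proof -
      have "ennreal M = ennreal (t powr p) * ennreal (8 ^ CARD('n) * b powr p / \<omega>)"
        unfolding M_def using \<omega> by (intro ennreal_mult) auto
      then show ?thesis by (simp only: mult.assoc)
    qed
    finally show ?thesis .
  qed
  have "(\<integral>\<^sup>+x. ennreal (norm (aniso_grad A f x) powr p) \<partial>lborel)
     \<le> (\<integral>\<^sup>+x. ennreal M * liminf (\<lambda>k. E k x) \<partial>lborel)"
    by (intro nn_integral_mono ptw)
  also have "\<dots> = ennreal M * (\<integral>\<^sup>+x. liminf (\<lambda>k. E k x) \<partial>lborel)"
    by (rule nn_integral_cmult) measurable
  finally have fin: "(\<integral>\<^sup>+x. ennreal (norm (aniso_grad A f x) powr p) \<partial>lborel) \<le> ennreal M * (\<integral>\<^sup>+x. liminf (\<lambda>k. E k x) \<partial>lborel)" .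
  have "(\<integral>\<^sup>+x. liminf (\<lambda>k. E k x) \<partial>lborel) \<le> liminf (\<lambda>k. \<integral>\<^sup>+x. E k x \<partial>lborel)"
    by (rule nn_integral_liminf) measurable
  also have "\<dots> \<le> weak_energy p A f"
    by (intro Liminf_le always_eventually allI E_le) simp
  finally have "ennreal M * (\<integral>\<^sup>+x. liminf (\<lambda>k. E k x) \<partial>lborel) \<le> ennreal M * weak_energy p A f"
    by (rule mult_left_mono) simp
  with fin show ?thesis unfolding M_def b_def \<omega>_def q_def by (rule order_trans)
qed

lemma invertible_matrix_norm_bounds:
  fixes A :: "real ^ 'n ^ 'n"
  assumes "invertible A"
  obtains c C where "c > 0" "C > 0" "\<And>h. c * norm h \<le> norm (A *v h)" "\<And>h. norm (A *v h) \<le> C * norm h"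
proof -
  have lin: "linear ((*v) A)" by (rule matrix_vector_mul_linear)
  obtain C where "C > 0" "\<And>h. norm (A *v h) \<le> C * norm h"
    using linear_bounded_pos[OF lin] by blast
  moreover obtain c where "c > 0" "\<And>h. c * norm h \<le> norm (A *v h)"
    using linear_inj_bounded_below_pos[OF lin inj_matrix_vector_mult[OF assms]] by blast
  ultimately show ?thesis using that by blast
qed

theorem theorem4p8:
  fixes p :: real and A :: "real ^ 'n ^ 'n"
  assumes "1 \<le> p" and "invertible A"
  shows "\<exists>C>0. \<forall>f\<in>Cc_star.
    ennreal (1 / C) * (\<integral>\<^sup>+ x. ennreal (norm (aniso_grad A f x) powr p) \<partial>lborel) \<le> weak_energy p A f \<and>
    weak_energy p A f \<le> ennreal C * (\<integral>\<^sup>+ x. ennreal (norm (aniso_grad A f x) powr p) \<partial>lborel)"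
proof -
  obtain a1 a2 where a: "a1 > 0" "a2 > 0" "\<And>h. a1 * norm h \<le> norm (A *v h)" "\<And>h. norm (A *v h) \<le> a2 * norm h"
    using invertible_matrix_norm_bounds[OF assms(2)] by blast
  obtain t1 t2 where t: "t1 > 0" "t2 > 0" "\<And>h. t1 * norm h \<le> norm (transpose A *v h)"
      "\<And>h. norm (transpose A *v h) \<le> t2 * norm h"
    using invertible_matrix_norm_bounds[OF transpose_invertible[OF assms(2)]] by blast
  define c where "c = a1 / sqrt (real CARD('n))"
  have c: "c > 0" using a by (simp add: c_def)
  have low: "c * norm h \<le> infnorm (A *v h)" for h
  proof -
    have "a1 * norm h \<le> sqrt (real CARD('n)) * infnorm (A *v h)"
      using a(3)[of h] norm_le_infnorm[of "A *v h"] by simp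
    then show ?thesis by (simp add: c_def field_simps)
  qed
  have up: "infnorm (A *v h) \<le> a2 * norm h" for h
    using infnorm_le_norm[of "A *v h"] a(4)[of h] by linarith
  have inj: "h = 0" if "A *v h = 0" for h using a(3)[of h] a(1) that by (simp add: mult_le_0_iff)
  define K1 where "K1 = (2 / c powr (1 + CARD('n) / p)) powr p * (4 * 5 ^ (CARD('n) + 1) * measure lborel (cball (0::real ^ 'n) 2))"
  define K2 where "K2 = t2 powr p * (8 ^ CARD('n) * (4 * a2 powr (1 + CARD('n) / p)) powr p / measure lborel (ball (0::real ^ 'n) 1))"
  have K: "K1 \<ge> 0" "K2 \<ge> 0" by (simp_all add: K1_def K2_def)
  define C where "C = 1 + K1 * (1 / t1) powr p + K2"
  have C: "C > 0" "K1 * (1 / t1) powr p \<le> C" "K2 \<le> C"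
    using K by (auto simp: C_def add_nonneg_nonneg add_pos_nonneg)
  have "ennreal (1 / C) * (\<integral>\<^sup>+ x. ennreal (norm (aniso_grad A f x) powr p) \<partial>lborel) \<le> weak_energy p A f \<and>
    weak_energy p A f \<le> ennreal C * (\<integral>\<^sup>+ x. ennreal (norm (aniso_grad A f x) powr p) \<partial>lborel)"
    if f: "f \<in> Cc_star" for f
  proof -
    obtain L where L: "L-lipschitz_on UNIV f" and cont: "continuous_on UNIV (Lip f)"
      and supp: "has_compact_support (Lip f)"
      using f by (auto simp: Cc_star_def)
    have fc: "continuous_on UNIV f" using L by (rule lipschitz_on_continuous_on)
    obtain B where B: "\<And>z. Lip f z \<le> B" using bounded_above_of_compact_support[OF cont supp] by blast
    have Lip0: "0 \<le> Lip f z" for z by (rule ereal_Lip(2)[OF L])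
    have [measurable]: "Lip f \<in> borel_measurable borel" by (rule borel_measurable_continuous_onI[OF cont])
    have AE: "AE x in lborel. f differentiable (at x)" by (rule AE_differentiable[OF L cont supp])
    define N where "N = (\<integral>\<^sup>+ x. ennreal (norm (aniso_grad A f x) powr p) \<partial>lborel)"
    define I where "I = (\<integral>\<^sup>+ x. ennreal (Lip f x powr p) \<partial>lborel)"
    have "N \<le> ennreal K2 * weak_energy p A f"
      unfolding N_def K2_def by (rule aniso_grad_le_weak_energy[OF assms(1) a(2) up inj t(2,4) fc])
    also have "\<dots> \<le> ennreal C * weak_energy p A f"
      using C by (intro mult_right_mono ennreal_leI) auto
    finally have "ennreal (1 / C) * N \<le> ennreal (1 / C) * (ennreal C * weak_energy p A f)"
      by (rule mult_left_mono) simp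
    also have "\<dots> = (ennreal (1 / C) * ennreal C) * weak_energy p A f" by (simp only: mult.assoc)
    also have "ennreal (1 / C) * ennreal C = 1" using C by (simp add: ennreal_mult[symmetric])
    finally have lower: "ennreal (1 / C) * N \<le> weak_energy p A f" by simp
    have "ennreal (t1 powr p) * I = (\<integral>\<^sup>+ x. ennreal (t1 powr p) * ennreal (Lip f x powr p) \<partial>lborel)"
      unfolding I_def by (rule nn_integral_cmult[symmetric]) measurable
    also have "\<dots> \<le> N"
      unfolding N_def
    proof (rule nn_integral_mono_AE, use AE in eventually_elim)
      case (elim x)
      have "t1 * Lip f x \<le> t1 * norm (grad f x)"
        using Lip_le_norm_grad[OF L elim] t(1) by (intro mult_left_mono) auto
      also have "\<dots> \<le> norm (aniso_grad A f x)" unfolding aniso_grad_def by (rule t(3))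
      finally have "(t1 * Lip f x) powr p \<le> norm (aniso_grad A f x) powr p"
        using Lip0 t(1) assms(1) by (intro powr_mono2) auto
      then show "ennreal (t1 powr p) * ennreal (Lip f x powr p) \<le> ennreal (norm (aniso_grad A f x) powr p)"
        using Lip0 t(1) by (simp add: powr_mult ennreal_mult[symmetric] ennreal_leI)
    qed
    finally have IN: "ennreal (t1 powr p) * I \<le> N" .
    have "K1 = K1 * (1 / t1) powr p * t1 powr p" using t(1) by (simp add: powr_divide)
    then have "ennreal K1 = ennreal (K1 * (1 / t1) powr p) * ennreal (t1 powr p)"
      using K by (metis ennreal_mult'' powr_ge_zero)
    then have "ennreal K1 * I = ennreal (K1 * (1 / t1) powr p) * (ennreal (t1 powr p) * I)"
      by (simp only: mult.assoc)
    also have "\<dots> \<le> ennreal C * N"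
      using C IN by (intro mult_mono ennreal_leI) auto
    finally have upper: "weak_energy p A f \<le> ennreal C * N"
      using weak_energy_le_Lip[OF assms(1) c low L cont B] unfolding I_def K1_def by (rule order_trans[rotated])
    show ?thesis using lower upper by (simp add: N_def)
  qed
  with C show ?thesis by blast
qed

end
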